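(* Let $G$ be a finite group and let $\varphi,\psi\in\mathrm{Irr}(G)$. Suppose $\varphi(1)\ge b(G)/a$ and $\psi(1)\ge b(G)/a$ for some real number $a\ge 1$. Then there exists $\rho\in\mathrm{Irr}(G)$ such that $$\rho(1)\;\ge\;\frac{b(G)}{a\cdot k(G)^{1/2}}\qquad\text{and}\qquad g(\rho,\varphi,\psi)\;\ge\;\frac{b(G)}{a^2\cdot k(G)}.$$
   Context: For a finite group $G$, $\mathrm{Irr}(G)$ is the set of irreducible complex characters of $G$; $k(G)=|\mathrm{Irr}(G)|$ is the number of conjugacy classes of $G$; $b(G)=\max_{\rho\in \mathrm{Irr}(G)}\rho(1)$ is the largest degree of an irreducible character. The Kronecker multiplicities $g(\rho,\varphi,\psi)$, for $\rho,\varphi,\psi\in\mathrm{Irr}(G)$, are the nonnegative integers defined by $\varphi\cdot\psi=\sum_{\rho\in\mathrm{Irr}(G)} g(\rho,\varphi,\psi)\,\rho$, where $\varphi\cdot\psi$ is the pointwise product of characters. *)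

theory Defs
  imports "HOL-Algebra.Algebra" "Jordan_Normal_Form.VS_Connect"
begin

definition mat_trace :: "complex mat \<Rightarrow> complex" where
  "mat_trace A = (\<Sum>i<dim_row A. A $$ (i, i))"

abbreviation GL :: "nat \<Rightarrow> complex mat monoid" where
  "GL n \<equiv> units_of (ring_mat TYPE(complex) n ())"

definition representation :: "('a, 'b) monoid_scheme \<Rightarrow> nat \<Rightarrow> ('a \<Rightarrow> complex mat) \<Rightarrow> bool" where
  "representation G n R \<longleftrightarrow> R \<in> hom G (GL n)"

definition invariant_subspace ::
    "('a, 'b) monoid_scheme \<Rightarrow> nat \<Rightarrow> ('a \<Rightarrow> complex mat) \<Rightarrow> complex vec set \<Rightarrow> bool" where
  "invariant_subspace G n R W \<longleftrightarrow>
     subspace class_ring W (module_vec TYPE(complex) n) \<and>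
     (\<forall>g\<in>carrier G. \<forall>w\<in>W. R g *\<^sub>v w \<in> W)"

definition irreducible_representation ::
    "('a, 'b) monoid_scheme \<Rightarrow> nat \<Rightarrow> ('a \<Rightarrow> complex mat) \<Rightarrow> bool" where
  "irreducible_representation G n R \<longleftrightarrow>
     representation G n R \<and> n > 0 \<and>
     (\<forall>W. invariant_subspace G n R W \<longrightarrow> W = {0\<^sub>v n} \<or> W = carrier_vec n)"

(* Restricting to the carrier makes a character unique as a HOL function,
   so that Irr G below contains each irreducible character exactly once. *)
definition rep_character :: "('a, 'b) monoid_scheme \<Rightarrow> ('a \<Rightarrow> complex mat) \<Rightarrow> 'a \<Rightarrow> complex" where
  "rep_character G R = (\<lambda>g\<in>carrier G. mat_trace (R g))"

definition Irr :: "('a, 'b) monoid_scheme \<Rightarrow> ('a \<Rightarrow> complex) set" where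
  "Irr G = {rep_character G R | n R. irreducible_representation G n R}"

(* The degree \<chi>(1); it is a natural number (see rep_character_one),
   so taking the real part loses nothing. *)
definition char_degree :: "('a, 'b) monoid_scheme \<Rightarrow> ('a \<Rightarrow> complex) \<Rightarrow> real" where
  "char_degree G \<chi> = Re (\<chi> \<one>\<^bsub>G\<^esub>)"

lemma rep_character_one:
  assumes "group G" and "representation G n R"
  shows "rep_character G R \<one>\<^bsub>G\<^esub> = of_nat n"
proof -
  interpret M: ring "ring_mat TYPE(complex) n ()" by (rule ring_mat)
  have "group_hom G (GL n) R"
    using assms M.units_group unfolding representation_def group_hom_def group_hom_axioms_def by simp
  then have "R \<one>\<^bsub>G\<^esub> = 1\<^sub>m n"
    using group_hom.hom_one by (fastforce simp: units_of_def ring_mat_def)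
  then show ?thesis
    using assms(1) by (simp add: rep_character_def mat_trace_def group.is_monoid monoid.one_closed)
qed

definition largest_degree :: "('a, 'b) monoid_scheme \<Rightarrow> real" where
  "largest_degree G = Max (char_degree G ` Irr G)"

(* k(G) = |Irr(G)|, which is also the number of conjugacy classes of G. *)
definition irr_count :: "('a, 'b) monoid_scheme \<Rightarrow> nat" where
  "irr_count G = card (Irr G)"

(* The multiplicities are the unique natural numbers expressing the pointwise product
   in terms of Irr G; the value 0 outside Irr G only makes the function unique. *)
definition kronecker_mult ::
    "('a, 'b) monoid_scheme \<Rightarrow> ('a \<Rightarrow> complex) \<Rightarrow> ('a \<Rightarrow> complex) \<Rightarrow> ('a \<Rightarrow> complex) \<Rightarrow> nat" where
  "kronecker_mult G \<rho> \<phi> \<psi> =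
     (THE m :: ('a \<Rightarrow> complex) \<Rightarrow> nat.
        (\<forall>\<chi>. \<chi> \<notin> Irr G \<longrightarrow> m \<chi> = 0) \<and>
        (\<forall>g\<in>carrier G. \<phi> g * \<psi> g = (\<Sum>\<chi>\<in>Irr G. of_nat (m \<chi>) * \<chi> g))) \<rho>"

end

theory Submission
  imports Defs "Jordan_Normal_Form.Schur_Decomposition" "Jordan_Normal_Form.Spectral_Radius"
begin

text \<open>
  Write \<open>m \<rho>\<close> for the multiplicity of \<open>\<rho>\<close> in \<open>\<phi> \<psi>\<close>. By orthogonality \<open>m \<rho>\<close> is the average of
  \<open>\<phi> g * \<psi> g * cnj (\<rho> g)\<close>; as \<open>\<bar>\<rho> g\<bar> \<le> \<rho> 1\<close> and \<open>\<phi>, \<psi>\<close> have norm 1, this gives \<open>m \<rho> \<le> \<rho> 1\<close>.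
  The sum of \<open>m \<rho> * \<rho> 1\<close> over the \<open>k\<close> irreducible characters is \<open>\<phi> 1 * \<psi> 1 \<ge> b\<^sup>2 / a\<^sup>2\<close>, so some \<open>\<rho>\<close>
  has \<open>m \<rho> * \<rho> 1 \<ge> b\<^sup>2 / (a\<^sup>2 k)\<close>. Bounding one factor by \<open>m \<rho> \<le> \<rho> 1\<close> and then by \<open>\<rho> 1 \<le> b\<close>
  yields the two inequalities.
\<close>

section \<open>Traces, subspaces and Kronecker products\<close>

text \<open>Sums over \<open>Irr G\<close> carry information only once \<open>Irr G\<close> is known
  to be finite: over an infinite set \<open>sum\<close> and \<open>card\<close> return 0 and
  \<open>Max\<close> is unspecified. Hence \<open>finite_Irr\<close> precedes the decomposition of
  characters, and the coefficient formula behind it is stated for finite subsets. The multiplicities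
  come from a definite description, so nothing is known about \<open>kronecker_mult\<close> until a
  decomposition of the product is shown to exist and to be unique. Uniqueness is orthogonality.
  Existence: the product is the trace of a Kronecker product of matrices, and a reducible
  representation splits, as far as traces can see, into a restriction and a quotient of smaller
  dimension. Orthogonality is proved with \<open>\<psi> (inv g)\<close> in place of the conjugate.
  Conjugates and norms enter separately, through the eigenvalues of matrices of finite
  order.\<close>

lemma mat_trace_mult_comm:
  assumes "A \<in> carrier_mat n m" and "B \<in> carrier_mat m n"
  shows "mat_trace (A * B) = mat_trace (B * A)"
proof -
  have "mat_trace (A * B) = (\<Sum>i<n. \<Sum>j<m. A $$ (i,j) * B $$ (j,i))"
    using assms by (simp add: mat_trace_def scalar_prod_def lessThan_atLeast0)
  also have "\<dots> = (\<Sum>j<m. \<Sum>i<n. B $$ (j,i) * A $$ (i,j))"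
    by (subst sum.swap) (simp add: mult.commute)
  also have "\<dots> = mat_trace (B * A)"
    using assms by (simp add: mat_trace_def scalar_prod_def lessThan_atLeast0)
  finally show ?thesis .
qed

lemma mat_trace_add:
  assumes "A \<in> carrier_mat n n" and "B \<in> carrier_mat n n"
  shows "mat_trace (A + B) = mat_trace A + mat_trace B"
  using assms by (simp add: mat_trace_def sum.distrib)

lemma mat_trace_one: "mat_trace (1\<^sub>m n) = of_nat n"
  by (simp add: mat_trace_def)

section \<open>Subspaces described by left-invertible matrices\<close>

text \<open>If \<open>n < r\<close>, padding both matrices with zeros to size \<open>r\<close> keeps
  the product \<open>1\<^sub>m r\<close>. For square matrices a one-sided inverse is two-sided, yet
  the padded \<open>A\<close> has a zero row at index \<open>n\<close>.\<close>

lemma left_inverse_dim_le: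
  fixes A B :: "'a :: field mat"
  assumes A: "A \<in> carrier_mat n r" and B: "B \<in> carrier_mat r n" and BA: "B * A = 1\<^sub>m r"
  shows "r \<le> n"
proof (rule ccontr)
  assume "\<not> r \<le> n"
  then have n: "n < r" by simp
  define A' where "A' = mat r r (\<lambda>(i,j). if i < n then A $$ (i,j) else 0)"
  define B' where "B' = mat r r (\<lambda>(i,j). if j < n then B $$ (i,j) else 0)"
  have C: "A' \<in> carrier_mat r r" "B' \<in> carrier_mat r r" by (auto simp: A'_def B'_def)
  have "B' * A' = 1\<^sub>m r"
  proof (rule eq_matI)
    fix i j assume ij: "i < dim_row (1\<^sub>m r :: 'a mat)" "j < dim_col (1\<^sub>m r :: 'a mat)"
    then have "(B' * A') $$ (i,j) = (\<Sum>k<r. if k < n then B $$ (i,k) * A $$ (k,j) else 0)"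
      by (simp add: A'_def B'_def scalar_prod_def lessThan_atLeast0 if_distrib cong: if_cong)
    also have "\<dots> = (\<Sum>k<n. B $$ (i,k) * A $$ (k,j))"
      using n by (intro sum.mono_neutral_cong_right) auto
    also have "\<dots> = (B * A) $$ (i,j)"
      using A B ij by (simp add: scalar_prod_def lessThan_atLeast0)
    finally show "(B' * A') $$ (i,j) = 1\<^sub>m r $$ (i,j)" using BA by simp
  qed (use C in auto)
  then have AB: "A' * B' = 1\<^sub>m r" using mat_mult_left_right_inverse C by blast
  have "(A' * B') $$ (n,n) = (\<Sum>k\<in>{0..<r}. A' $$ (n,k) * B' $$ (k,n))"
    using C n by (simp add: scalar_prod_def)
  also have "\<dots> = 0" using n by (simp add: A'_def)
  finally show False using AB n by simp
qed

lemma zero_mult_mat_vec: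
  assumes "v \<in> carrier_vec m"
  shows "0\<^sub>m n m *\<^sub>v v = 0\<^sub>v n"
  using assms by (intro eq_vecI) auto

lemma vec_eq_zero_if_components:
  assumes "v \<in> carrier_vec n" "\<And>i. i < n \<Longrightarrow> v $ i = 0" shows "v = 0\<^sub>v n"
  using assms by (intro eq_vecI) auto

lemma mat_eqI_mult_vec:
  fixes A B :: "'a :: comm_ring_1 mat"
  assumes A: "A \<in> carrier_mat n m" and B: "B \<in> carrier_mat n m"
    and eq: "\<And>v. v \<in> carrier_vec m \<Longrightarrow> A *\<^sub>v v = B *\<^sub>v v"
  shows "A = B"
proof (rule eq_matI)
  fix i j assume ij: "i < dim_row B" "j < dim_col B"
  have "(A *\<^sub>v unit_vec m j) $ i = A $$ (i,j)" "(B *\<^sub>v unit_vec m j) $ i = B $$ (i,j)"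
    using A B ij by (auto)
  then show "A $$ (i,j) = B $$ (i,j)" using eq[of "unit_vec m j"] by simp
qed (use A B in auto)

definition vec_subspace :: "nat \<Rightarrow> 'a :: field vec set \<Rightarrow> bool" where
  "vec_subspace n W \<longleftrightarrow> W \<subseteq> carrier_vec n \<and> 0\<^sub>v n \<in> W \<and>
     (\<forall>v\<in>W. \<forall>w\<in>W. v + w \<in> W) \<and> (\<forall>c. \<forall>v\<in>W. c \<cdot>\<^sub>v v \<in> W)"

lemma subspace_iff_vec_subspace:
  "subspace class_ring W (module_vec TYPE('a :: field) n) \<longleftrightarrow> vec_subspace n W"
proof -
  interpret vec_space "TYPE('a)" n .
  have "vectorspace class_ring (module_vec TYPE('a :: field) n)" ..
  moreover have "module class_ring (module_vec TYPE('a :: field) n)" ..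
  ultimately show ?thesis
    unfolding subspace_def submodule_def vec_subspace_def by (auto simp: module_vec_simps)
qed

text \<open>
  \<open>A\<close> embeds an \<open>r\<close>-dimensional space into \<open>W\<close> and \<open>B\<close> is a left inverse. A maximal such pair
  plays the role of a basis of \<open>W\<close> extended to the whole space.
\<close>
definition retract_onto :: "nat \<Rightarrow> nat \<Rightarrow> 'a :: field mat \<Rightarrow> 'a mat \<Rightarrow> 'a vec set \<Rightarrow> bool" where
  "retract_onto n r A B W \<longleftrightarrow> A \<in> carrier_mat n r \<and> B \<in> carrier_mat r n \<and> B * A = 1\<^sub>m r \<and>
     (\<forall>v\<in>carrier_vec r. A *\<^sub>v v \<in> W)"

text \<open>\<open>E = 1\<^sub>m n - A * B\<close> is the idempotent complementary to the projection
  \<open>A * B\<close>. The vector \<open>u = E *\<^sub>v w\<close> measures how far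
  \<open>w\<close> is from being fixed; it is nonzero, stays in \<open>W\<close>, and becomes the
  new column of \<open>A\<close>.\<close>

lemma retract_extend:
  fixes A B :: "'a :: field mat"
  assumes W: "vec_subspace n W" and R: "retract_onto n r A B W"
    and w: "w \<in> W" and ne: "A *\<^sub>v (B *\<^sub>v w) \<noteq> w"
  shows "\<exists>A' B'. retract_onto n (Suc r) A' B' W"
proof -
  have A: "A \<in> carrier_mat n r" and B: "B \<in> carrier_mat r n" and BA: "B * A = 1\<^sub>m r"
    and AW: "\<And>v. v \<in> carrier_vec r \<Longrightarrow> A *\<^sub>v v \<in> W"
    using R by (auto simp: retract_onto_def)
  have wn: "w \<in> carrier_vec n" using W w by (auto simp: vec_subspace_def)
  define E where "E = 1\<^sub>m n - A * B"
  have E: "E \<in> carrier_mat n n" using A B by (auto simp: E_def)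
  have EA: "E * A = 0\<^sub>m n r"
    using A B BA by (simp add: E_def minus_mult_distrib_mat[of _ n n] assoc_mult_mat[of A n r B n A r])
  have BE: "B * E = 0\<^sub>m r n"
    using A B BA by (simp add: E_def mult_minus_distrib_mat[of _ r n _ n] assoc_mult_mat[of B r n A r B n, symmetric])
  have "E * E = E - (A * B) * E"
    using A B E by (subst (1) E_def) (simp add: minus_mult_distrib_mat[of _ n n])
  also have "(A * B) * E = 0\<^sub>m n n" using A B E BE by (simp add: assoc_mult_mat[of A n r B n E n])
  also have "E - 0\<^sub>m n n = E" using E by (intro eq_matI) auto
  finally have EE: "E * E = E" .
  define u where "u = E *\<^sub>v w"
  have un: "u \<in> carrier_vec n" using E wn by (simp add: u_def)
  have u_eq: "u = w + (-1) \<cdot>\<^sub>v (A *\<^sub>v (B *\<^sub>v w))"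
    using A B wn by (intro eq_vecI) (auto simp: u_def E_def minus_mult_distrib_mat_vec[of _ n n])
  have uW: "u \<in> W"
    unfolding u_eq using W w AW[of "B *\<^sub>v w"] B wn by (auto simp: vec_subspace_def)
  have "u \<noteq> 0\<^sub>v n"
  proof
    assume "u = 0\<^sub>v n"
    then have "(w + (-1) \<cdot>\<^sub>v (A *\<^sub>v (B *\<^sub>v w))) $ i = 0" if "i < n" for i
      using that u_eq by simp
    then have "A *\<^sub>v (B *\<^sub>v w) = w"
      using A B wn by (intro eq_vecI) auto
    then show False using ne by simp
  qed
  then obtain k where k: "k < n" "u $ k \<noteq> 0" using vec_eq_zero_if_components[OF un] by blast
  have Eu: "E *\<^sub>v u = u" using EE E wn by (metis assoc_mult_mat_vec u_def)
  have Bu: "B *\<^sub>v u = 0\<^sub>v r" using BE B E wn unfolding u_def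
    by (metis assoc_mult_mat_vec zero_mult_mat_vec)
  \<comment> \<open>The new row of \<open>B\<close> must kill the old columns and take the value 1
    on \<open>u\<close>. Row \<open>k\<close> of \<open>E\<close> kills the columns of
    \<open>A\<close> because \<open>E * A = 0\<close>, and it sends \<open>u\<close> to
    \<open>u $ k\<close> because \<open>E *\<^sub>v u = u\<close>; hence the scaling.\<close>
  define y where "y = (1 / u $ k) \<cdot>\<^sub>v row E k"
  define A' where "A' = mat n (Suc r) (\<lambda>(i,j). if j < r then A $$ (i,j) else u $ i)"
  define B' where "B' = mat (Suc r) n (\<lambda>(i,j). if i < r then B $$ (i,j) else y $ j)"
  have C: "A' \<in> carrier_mat n (Suc r)" "B' \<in> carrier_mat (Suc r) n" by (auto simp: A'_def B'_def)
  have colA: "col A' j = (if j < r then col A j else u)" if "j < Suc r" for j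
    using that A un by (intro eq_vecI) (auto simp: A'_def)
  have rowB: "row B' i = (if i < r then row B i else y)" if "i < Suc r" for i
    using that B E k by (intro eq_vecI) (auto simp: B'_def y_def)
  have "B' * A' = 1\<^sub>m (Suc r)"
  proof (rule eq_matI)
    fix i j assume "i < dim_row (1\<^sub>m (Suc r) :: 'a mat)" "j < dim_col (1\<^sub>m (Suc r) :: 'a mat)"
    then have ij: "i < Suc r" "j < Suc r" by auto
    have e: "(B' * A') $$ (i,j) = row B' i \<bullet> col A' j" using C ij by simp
    have 1: "row B i \<bullet> col A j = 1\<^sub>m r $$ (i,j)" if "i < r" "j < r"
      using that A B BA by (metis carrier_matD index_mult_mat(1))
    have 2: "row B i \<bullet> u = 0" if "i < r"
      using that B Bu by (metis carrier_matD(1) index_mult_mat_vec index_zero_vec(1))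
    have 3: "row E k \<bullet> col A j = 0" if "j < r"
      using that k E A EA by (metis carrier_matD index_mult_mat(1) index_zero_mat(1))
    have 4: "row E k \<bullet> u = u $ k"
      using k E Eu by (metis carrier_matD(1) index_mult_mat_vec)
    show "(B' * A') $$ (i,j) = 1\<^sub>m (Suc r) $$ (i,j)"
      using ij 1 2 3 4 k A E un unfolding e by (auto simp: colA rowB y_def)
  qed (use C in auto)
  moreover have "A' *\<^sub>v v \<in> W" if v: "v \<in> carrier_vec (Suc r)" for v
  proof -
    have "A' *\<^sub>v v = A *\<^sub>v vec r (\<lambda>i. v $ i) + v $ r \<cdot>\<^sub>v u"
      using A un v by (intro eq_vecI) (auto simp: A'_def scalar_prod_def)
    then show ?thesis using AW[of "vec r (\<lambda>i. v $ i)"] uW W by (auto simp: vec_subspace_def)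
  qed
  ultimately show ?thesis using C by (auto simp: retract_onto_def)
qed

text \<open>Left invertibility bounds \<open>r\<close> by \<open>n\<close>, so a greatest
  \<open>r\<close> exists. A vector of \<open>W\<close> not fixed by \<open>A * B\<close> would
  allow an extension to \<open>Suc r\<close>.\<close>

lemma vec_subspace_retract:
  fixes W :: "'a :: field vec set"
  assumes W: "vec_subspace n W"
  obtains r A B where "retract_onto n r A B W" "\<And>w. w \<in> W \<Longrightarrow> A *\<^sub>v (B *\<^sub>v w) = w"
proof -
  let ?P = "\<lambda>r. \<exists>A B. retract_onto n r A B W"
  have "retract_onto n 0 (0\<^sub>m n 0) (0\<^sub>m 0 n) W"
    using W by (auto simp: retract_onto_def vec_subspace_def zero_mult_mat_vec)
  then have P0: "?P 0" by blast
  have bound: "r \<le> n" if "?P r" for r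
    using that left_inverse_dim_le by (auto simp: retract_onto_def)
  obtain r where r: "?P r" and max: "\<And>s. ?P s \<Longrightarrow> s \<le> r"
    using GreatestI_nat[of ?P, OF P0 bound] Greatest_le_nat[of ?P, OF _ bound] by blast
  then obtain A B where R: "retract_onto n r A B W" by blast
  have "A *\<^sub>v (B *\<^sub>v w) = w" if "w \<in> W" for w
    using retract_extend[OF W R that] max[of "Suc r"] by auto
  with R that show ?thesis by blast
qed

section \<open>Triangular matrices and matrices of finite order\<close>

lemma upper_triangular_mult:
  fixes A B :: "'a :: comm_ring_1 mat"
  assumes A: "A \<in> carrier_mat n n" and B: "B \<in> carrier_mat n n"
    and uA: "upper_triangular A" and uB: "upper_triangular B"
  shows "upper_triangular (A * B)" and "\<And>i. i < n \<Longrightarrow> (A * B) $$ (i,i) = A $$ (i,i) * B $$ (i,i)"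
proof -
  have e: "(A * B) $$ (i,j) = (\<Sum>k<n. A $$ (i,k) * B $$ (k,j))" if "i < n" "j < n" for i j
    using that A B by (simp add: scalar_prod_def lessThan_atLeast0)
  have z: "A $$ (i,k) * B $$ (k,j) = 0" if "i < n" "k < n" "j \<le> i" "k \<noteq> i \<or> j < i" for i j k
  proof (cases "k < i")
    case True
    then show ?thesis using uA A that by (auto simp: upper_triangular_def)
  next
    case False
    then show ?thesis using uB B that by (auto simp: upper_triangular_def)
  qed
  show "upper_triangular (A * B)"
  proof
    fix i j assume "j < i" "i < dim_row (A * B)"
    then show "(A * B) $$ (i,j) = 0" using A z[of i _ j] by (simp add: e)
  qed
  show "(A * B) $$ (i,i) = A $$ (i,i) * B $$ (i,i)" if i: "i < n" for i
  proof -
    have "(\<Sum>k<n. A $$ (i,k) * B $$ (k,i)) = (\<Sum>k\<in>{i}. A $$ (i,k) * B $$ (k,i))"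
      using i z[of i _ i] by (intro sum.mono_neutral_right) auto
    then show ?thesis using e[OF i i] by simp
  qed
qed

lemma upper_triangular_pow:
  fixes T :: "'a :: comm_ring_1 mat"
  assumes T: "T \<in> carrier_mat n n" and u: "upper_triangular T"
  shows "upper_triangular (T ^\<^sub>m k) \<and> (\<forall>i<n. (T ^\<^sub>m k) $$ (i,i) = (T $$ (i,i)) ^ k)"
proof (induction k)
  case 0
  then show ?case using T by auto
next
  case (Suc k)
  have "T ^\<^sub>m k \<in> carrier_mat n n" using T by simp
  from upper_triangular_mult[OF this T] Suc u show ?case by simp
qed

text \<open>The eigenvalues, read off a triangularization, are roots of unity.\<close>
lemma mat_trace_finite_order:
  assumes A: "A \<in> carrier_mat n n" and N: "N > 0" and AN: "A ^\<^sub>m N = 1\<^sub>m n"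
  shows "mat_trace (A ^\<^sub>m (N - 1)) = cnj (mat_trace A)" and "cmod (mat_trace A) \<le> real n"
proof -
  obtain es where "char_poly A = (\<Prod>a\<leftarrow>es. [:- a, 1:])" using char_poly_factorized[OF A] by blast
  then obtain T where T: "T \<in> carrier_mat n n" and u: "upper_triangular T" and "similar_mat A T"
    using schur_decomposition_exists[OF A] by blast
  then obtain P Q where PQ: "similar_mat_wit A T P Q" by (auto simp: similar_mat_def)
  then have P: "P \<in> carrier_mat n n" and Q: "Q \<in> carrier_mat n n" and QP: "Q * P = 1\<^sub>m n" and "P * Q = 1\<^sub>m n"
    using similar_mat_witD2[OF A PQ] by auto
  have tr: "mat_trace (A ^\<^sub>m k) = (\<Sum>i<n. (T $$ (i,i)) ^ k)" for k
  proof -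
    have Tk: "T ^\<^sub>m k \<in> carrier_mat n n" using T by simp
    have "mat_trace (A ^\<^sub>m k) = mat_trace ((P * T ^\<^sub>m k) * Q)"
      using similar_mat_wit_pow_id[OF PQ] by simp
    also have "\<dots> = mat_trace (Q * (P * T ^\<^sub>m k))"
      using mat_trace_mult_comm[of "P * T ^\<^sub>m k" n n Q] P Q Tk by simp
    also have "Q * (P * T ^\<^sub>m k) = T ^\<^sub>m k"
      using assoc_mult_mat[OF Q P Tk] left_mult_one_mat[OF Tk] QP by simp
    also have "mat_trace (T ^\<^sub>m k) = (\<Sum>i<n. (T $$ (i,i)) ^ k)"
      using upper_triangular_pow[OF T u, of k] T by (simp add: mat_trace_def)
    finally show ?thesis .
  qed
  have "T ^\<^sub>m N = Q * A ^\<^sub>m N * P"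
    using similar_mat_wit_pow_id[OF similar_mat_wit_sym[OF PQ]] .
  then have "T ^\<^sub>m N = 1\<^sub>m n" using AN QP P Q by simp
  then have root: "(T $$ (i,i)) ^ N = 1" if "i < n" for i
    using upper_triangular_pow[OF T u, of N] that by simp
  have cm: "cmod (T $$ (i,i)) = 1" if "i < n" for i
    using root[OF that] N by (metis norm_ge_zero norm_one norm_power power_eq_1_iff not_less_zero)
  \<comment> \<open>Both sides are the inverse of the eigenvalue: the left one because its
    \<open>N\<close>-th power is 1, the right one because its modulus is 1.\<close>
  have cj: "(T $$ (i,i)) ^ (N - 1) = cnj (T $$ (i,i))" if "i < n" for i
  proof -
    have "T $$ (i,i) * (T $$ (i,i)) ^ (N - 1) = T $$ (i,i) * cnj (T $$ (i,i))"
      using root[OF that] cm[OF that] N by (simp add: complex_norm_square[symmetric] power_eq_if)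
    moreover have "T $$ (i,i) \<noteq> 0" using cm[OF that] by auto
    ultimately show ?thesis by simp
  qed
  have tr1: "mat_trace A = (\<Sum>i<n. T $$ (i,i))" using tr[of 1] A by simp
  show "mat_trace (A ^\<^sub>m (N - 1)) = cnj (mat_trace A)"
    unfolding tr tr1 cnj_sum by (intro sum.cong) (simp_all add: cj del: One_nat_def)
  have "cmod (\<Sum>i<n. T $$ (i,i)) \<le> (\<Sum>i<n. cmod (T $$ (i,i)))" by (rule norm_sum)
  then show "cmod (mat_trace A) \<le> real n" by (simp add: tr1 cm)
qed

section \<open>Kronecker products of matrices\<close>

text \<open>The matrix of a tensor product of linear maps in the lexicographically ordered product
  basis: an index encodes a pair by quotient and remainder.\<close>

definition kron :: "'a :: comm_semiring_1 mat \<Rightarrow> 'a mat \<Rightarrow> 'a mat" where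
  "kron A B = mat (dim_row A * dim_row B) (dim_col A * dim_col B)
     (\<lambda>(i,j). A $$ (i div dim_row B, j div dim_col B) * B $$ (i mod dim_row B, j mod dim_col B))"

text \<open>Turns a sum over encoded pairs into a double sum, which is how traces and products of
  Kronecker products are evaluated.\<close>

lemma sum_div_mod:
  fixes f :: "nat \<Rightarrow> nat \<Rightarrow> 'a :: comm_monoid_add"
  shows "(\<Sum>k<n*m. f (k div m) (k mod m)) = (\<Sum>i<n. \<Sum>j<m. f i j)"
proof (cases "m = 0")
  case False
  have lt: "i * m + j < n * m" if "i < n" "j < m" for i j
  proof -
    have "i * m + j < Suc i * m" using that by simp
    also have "\<dots> \<le> n * m" using that by (intro mult_right_mono) auto
    finally show ?thesis .
  qed
  have "(\<Sum>k<n*m. f (k div m) (k mod m)) = (\<Sum>(i,j)\<in>{..<n} \<times> {..<m}. f i j)"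
    using False lt
    by (intro sum.reindex_bij_witness[where i = "\<lambda>(i,j). i * m + j" and j = "\<lambda>k. (k div m, k mod m)"])
      (auto simp: less_mult_imp_div_less)
  then show ?thesis by (simp add: sum.cartesian_product)
qed simp

lemma mat_trace_kron:
  assumes "A \<in> carrier_mat n n" "B \<in> carrier_mat m m"
  shows "mat_trace (kron A B) = mat_trace A * mat_trace B"
  using assms sum_div_mod[of "\<lambda>i j. A $$ (i,i) * B $$ (j,j)" m n]
  by (simp add: mat_trace_def kron_def sum_product)

lemma kron_one: "kron (1\<^sub>m n) (1\<^sub>m m) = (1\<^sub>m (n * m) :: 'a :: comm_semiring_1 mat)"
proof (rule eq_matI)
  fix i j assume "i < dim_row (1\<^sub>m (n * m) :: 'a mat)" "j < dim_col (1\<^sub>m (n * m) :: 'a mat)"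
  then have ij: "i < n * m" "j < n * m" by auto
  then have "m > 0" by (cases m) auto
  moreover have "i = j \<longleftrightarrow> i div m = j div m \<and> i mod m = j mod m" by (metis div_mult_mod_eq)
  ultimately show "kron (1\<^sub>m n) (1\<^sub>m m) $$ (i,j) = (1\<^sub>m (n * m) :: 'a mat) $$ (i,j)"
    using ij by (auto simp: kron_def less_mult_imp_div_less)
qed (auto simp: kron_def)

lemma kron_mult:
  fixes A A' B B' :: "'a :: comm_semiring_1 mat"
  assumes A: "A \<in> carrier_mat n n" "A' \<in> carrier_mat n n" and B: "B \<in> carrier_mat m m" "B' \<in> carrier_mat m m"
  shows "kron (A * A') (B * B') = kron A B * kron A' B'"
proof (rule eq_matI)
  fix i j assume "i < dim_row (kron A B * kron A' B')" "j < dim_col (kron A B * kron A' B')"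
  then have ij: "i < n * m" "j < n * m" using A B by (auto simp: kron_def)
  then have m: "m > 0" by (cases m) auto
  have d: "i div m < n" "j div m < n" "i mod m < m" "j mod m < m"
    using ij m by (auto simp: less_mult_imp_div_less)
  have "(kron A B * kron A' B') $$ (i,j) =
      (\<Sum>k<n*m. (A $$ (i div m, k div m) * B $$ (i mod m, k mod m)) * (A' $$ (k div m, j div m) * B' $$ (k mod m, j mod m)))"
    using ij A B by (simp add: kron_def scalar_prod_def lessThan_atLeast0)
  also have "\<dots> = (\<Sum>p<n. \<Sum>q<m. (A $$ (i div m, p) * B $$ (i mod m, q)) * (A' $$ (p, j div m) * B' $$ (q, j mod m)))"
    by (rule sum_div_mod)
  also have "\<dots> = (\<Sum>p<n. A $$ (i div m, p) * A' $$ (p, j div m)) * (\<Sum>q<m. B $$ (i mod m, q) * B' $$ (q, j mod m))"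
    by (simp add: sum_product mult_ac)
  also have "\<dots> = (A * A') $$ (i div m, j div m) * (B * B') $$ (i mod m, j mod m)"
    using A B d by (simp add: scalar_prod_def lessThan_atLeast0)
  also have "\<dots> = kron (A * A') (B * B') $$ (i,j)" using A B ij by (simp add: kron_def)
  finally show "kron (A * A') (B * B') $$ (i,j) = (kron A B * kron A' B') $$ (i,j)" by simp
qed (use A B in \<open>auto simp: kron_def\<close>)

section \<open>Schur's lemma\<close>

locale fin_group = group G for G (structure) +
  assumes fin: "finite (carrier G)"
begin

text \<open>Replaces the homomorphism into the unit group by plain matrix identities. Invertibility
  of \<open>R g\<close> is implicit in them, since \<open>R (inv g)\<close> is a two-sided
  inverse.\<close>

lemma representation_iff:
  "representation G n R \<longleftrightarrow>
     (\<forall>g\<in>carrier G. R g \<in> carrier_mat n n) \<and> R \<one> = 1\<^sub>m n \<and>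
     (\<forall>g\<in>carrier G. \<forall>h\<in>carrier G. R (g \<otimes> h) = R g * R h)"
proof
  assume rep: "representation G n R"
  interpret M: ring "ring_mat TYPE(complex) n ()" by (rule ring_mat)
  have "group_hom G (GL n) R"
    using rep M.units_group is_group unfolding representation_def group_hom_def group_hom_axioms_def by simp
  then have "R \<one> = 1\<^sub>m n"
    using group_hom.hom_one by (fastforce simp: units_of_def ring_mat_def)
  moreover have "R g \<in> carrier_mat n n" if "g \<in> carrier G" for g
  proof -
    have "R g \<in> Units (ring_mat TYPE(complex) n ())"
      using rep that unfolding representation_def hom_def units_of_def by auto
    then show ?thesis by (simp add: Units_def ring_mat_def)
  qed
  moreover have "R (g \<otimes> h) = R g * R h" if "g \<in> carrier G" "h \<in> carrier G" for g h
    using rep that hom_mult[of R G "GL n" g h]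
    by (simp add: representation_def units_of_def ring_mat_def)
  ultimately show "(\<forall>g\<in>carrier G. R g \<in> carrier_mat n n) \<and> R \<one> = 1\<^sub>m n \<and>
     (\<forall>g\<in>carrier G. \<forall>h\<in>carrier G. R (g \<otimes> h) = R g * R h)" by blast
next
  assume R: "(\<forall>g\<in>carrier G. R g \<in> carrier_mat n n) \<and> R \<one> = 1\<^sub>m n \<and>
     (\<forall>g\<in>carrier G. \<forall>h\<in>carrier G. R (g \<otimes> h) = R g * R h)"
  then have Rc: "\<And>g. g \<in> carrier G \<Longrightarrow> R g \<in> carrier_mat n n" and R1: "R \<one> = 1\<^sub>m n"
    and Rm: "\<And>g h. g \<in> carrier G \<Longrightarrow> h \<in> carrier G \<Longrightarrow> R (g \<otimes> h) = R g * R h" by blast+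
  have "R g \<in> Units (ring_mat TYPE(complex) n ())" if g: "g \<in> carrier G" for g
  proof -
    have "R (inv g) * R g = 1\<^sub>m n" "R g * R (inv g) = 1\<^sub>m n" "R (inv g) \<in> carrier_mat n n"
      using Rm[of "inv g" g] Rm[of g "inv g"] g R1 Rc by auto
    then show ?thesis using Rc[OF g] unfolding Units_def ring_mat_def by auto
  qed
  then show "representation G n R"
    unfolding representation_def by (intro homI) (simp_all add: units_of_def ring_mat_def Rm)
qed

lemma representationD:
  assumes "representation G n R"
  shows rep_carrier: "\<And>g. g \<in> carrier G \<Longrightarrow> R g \<in> carrier_mat n n"
    and rep_one: "R \<one> = 1\<^sub>m n"
    and rep_mult: "\<And>g h. g \<in> carrier G \<Longrightarrow> h \<in> carrier G \<Longrightarrow> R (g \<otimes> h) = R g * R h"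
  using assms by (auto simp: representation_iff)

lemma irreducible_iff:
  "irreducible_representation G n R \<longleftrightarrow>
     representation G n R \<and> n > 0 \<and>
     (\<forall>W. vec_subspace n W \<longrightarrow> (\<forall>g\<in>carrier G. \<forall>w\<in>W. R g *\<^sub>v w \<in> W) \<longrightarrow>
        W = {0\<^sub>v n} \<or> W = carrier_vec n)"
  by (simp add: irreducible_representation_def invariant_subspace_def subspace_iff_vec_subspace imp_conjL)

text \<open>A \<open>G\<close>-equivariant linear map; the source \<open>R\<close> comes first, the
  target \<open>S\<close> second.\<close>

definition intertwiner :: "nat \<Rightarrow> ('a \<Rightarrow> complex mat) \<Rightarrow> nat \<Rightarrow> ('a \<Rightarrow> complex mat) \<Rightarrow> complex mat \<Rightarrow> bool" where
  "intertwiner n R m S A \<longleftrightarrow> A \<in> carrier_mat m n \<and> (\<forall>g\<in>carrier G. S g * A = A * R g)"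

text \<open>The kernel of \<open>A\<close> is invariant under \<open>R\<close>, hence zero or
  everything, and the latter would make \<open>A\<close> zero.\<close>

lemma schur_kernel:
  assumes R: "irreducible_representation G n R" and S: "representation G m S"
    and A: "intertwiner n R m S A" and ne: "A \<noteq> 0\<^sub>m m n"
    and v: "v \<in> carrier_vec n" and Av: "A *\<^sub>v v = 0\<^sub>v m"
  shows "v = 0\<^sub>v n"
proof -
  let ?W = "{v \<in> carrier_vec n. A *\<^sub>v v = 0\<^sub>v m}"
  have Am: "A \<in> carrier_mat m n" and AR: "\<And>g. g \<in> carrier G \<Longrightarrow> S g * A = A * R g"
    using A by (auto simp: intertwiner_def)
  have rR: "representation G n R" using R by (simp add: irreducible_iff)
  have "vec_subspace n ?W"
    using Am by (auto simp: vec_subspace_def mult_add_distrib_mat_vec[of _ m n] mult_mat_vec[of _ m n])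
  moreover have "R g *\<^sub>v w \<in> ?W" if g: "g \<in> carrier G" and w: "w \<in> ?W" for g w
  proof -
    have Rg: "R g \<in> carrier_mat n n" and Sg: "S g \<in> carrier_mat m m"
      using rep_carrier g rR S by auto
    have "A *\<^sub>v (R g *\<^sub>v w) = (A * R g) *\<^sub>v w" using Am Rg w by (simp add: assoc_mult_mat_vec[of A m n])
    also have "\<dots> = S g *\<^sub>v (A *\<^sub>v w)"
      unfolding AR[OF g, symmetric] using Am Sg w by (simp add: assoc_mult_mat_vec[of _ m m])
    also have "\<dots> = 0\<^sub>v m" using w Sg by (auto intro!: eq_vecI)
    finally show ?thesis using Rg w by auto
  qed
  ultimately have "?W = {0\<^sub>v n} \<or> ?W = carrier_vec n" using R unfolding irreducible_iff by blast
  moreover have "?W \<noteq> carrier_vec n"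
  proof
    assume "?W = carrier_vec n"
    then have "A *\<^sub>v v = 0\<^sub>m m n *\<^sub>v v" if "v \<in> carrier_vec n" for v
      using that zero_mult_mat_vec[OF that] \<open>?W = carrier_vec n\<close> by auto
    then show False using ne mat_eqI_mult_vec[OF Am zero_carrier_mat] by blast
  qed
  ultimately show ?thesis using v Av by blast
qed

text \<open>The dual argument: the image of \<open>A\<close> is invariant under \<open>S\<close> and
  nonzero, hence everything.\<close>

lemma schur_range:
  assumes R: "representation G n R" and S: "irreducible_representation G m S"
    and A: "intertwiner n R m S A" and ne: "A \<noteq> 0\<^sub>m m n"
    and w: "w \<in> carrier_vec m"
  obtains v where "v \<in> carrier_vec n" "A *\<^sub>v v = w"
proof -
  let ?W = "(\<lambda>v. A *\<^sub>v v) ` carrier_vec n"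
  have Am: "A \<in> carrier_mat m n" and AR: "\<And>g. g \<in> carrier G \<Longrightarrow> S g * A = A * R g"
    using A by (auto simp: intertwiner_def)
  have rS: "representation G m S" using S by (simp add: irreducible_iff)
  have "vec_subspace m ?W"
    unfolding vec_subspace_def
  proof (intro conjI ballI allI)
    show "?W \<subseteq> carrier_vec m" using Am by auto
    have "A *\<^sub>v 0\<^sub>v n = 0\<^sub>v m" using Am by (intro eq_vecI) auto
    then show "0\<^sub>v m \<in> ?W" by (metis image_eqI zero_carrier_vec)
    show "v + w \<in> ?W" if vw: "v \<in> ?W" "w \<in> ?W" for v w
    proof -
      obtain x y where "x \<in> carrier_vec n" "y \<in> carrier_vec n" "v = A *\<^sub>v x" "w = A *\<^sub>v y"
        using vw by blast
      then show ?thesis using mult_add_distrib_mat_vec[OF Am, of x y] by (metis add_carrier_vec imageI)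
    qed
    show "c \<cdot>\<^sub>v v \<in> ?W" if v: "v \<in> ?W" for c v
    proof -
      obtain x where "x \<in> carrier_vec n" "v = A *\<^sub>v x" using v by blast
      then show ?thesis using mult_mat_vec[OF Am, of x c] by (metis smult_carrier_vec imageI)
    qed
  qed
  moreover have "S g *\<^sub>v w \<in> ?W" if g: "g \<in> carrier G" and w: "w \<in> ?W" for g w
  proof -
    obtain v where v: "v \<in> carrier_vec n" "w = A *\<^sub>v v" using w by auto
    have Rg: "R g \<in> carrier_mat n n" and Sg: "S g \<in> carrier_mat m m"
      using rep_carrier g R rS by auto
    have "S g *\<^sub>v w = (S g * A) *\<^sub>v v" using Am Sg v by (simp add: assoc_mult_mat_vec[of _ m m])
    also have "\<dots> = A *\<^sub>v (R g *\<^sub>v v)"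
      unfolding AR[OF g] using Am Rg v by (simp add: assoc_mult_mat_vec[of A m n])
    finally show ?thesis using Rg v by auto
  qed
  ultimately have "?W = {0\<^sub>v m} \<or> ?W = carrier_vec m" using S unfolding irreducible_iff by blast
  moreover have "?W \<noteq> {0\<^sub>v m}"
  proof
    assume "?W = {0\<^sub>v m}"
    then have "A *\<^sub>v v = 0\<^sub>m m n *\<^sub>v v" if "v \<in> carrier_vec n" for v
      using that zero_mult_mat_vec[OF that] \<open>?W = {0\<^sub>v m}\<close> by auto
    then show False using ne mat_eqI_mult_vec[OF Am zero_carrier_mat] by blast
  qed
  ultimately have "?W = carrier_vec m" by simp
  then have "w \<in> ?W" using w by simp
  then obtain v where "v \<in> carrier_vec n" "w = A *\<^sub>v v" by (rule imageE)
  then show ?thesis using that by simp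
qed

text \<open>Such an \<open>A\<close> is bijective. Its inverse \<open>B\<close> gives
  \<open>R g = B * (S g * A)\<close>, and cyclicity of the trace removes \<open>A\<close> and
  \<open>B\<close>.\<close>

lemma schur_iso:
  assumes R: "irreducible_representation G n R" and S: "irreducible_representation G m S"
    and A: "intertwiner n R m S A" and ne: "A \<noteq> 0\<^sub>m m n"
  shows "rep_character G R = rep_character G S"
proof -
  have Am: "A \<in> carrier_mat m n" and AR: "\<And>g. g \<in> carrier G \<Longrightarrow> S g * A = A * R g"
    using A by (auto simp: intertwiner_def)
  have rR: "representation G n R" and rS: "representation G m S" using R S by (simp_all add: irreducible_iff)
  have "\<forall>j. \<exists>v. v \<in> carrier_vec n \<and> A *\<^sub>v v = unit_vec m j"
    using schur_range[OF rR S A ne] by (metis unit_vec_carrier)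
  \<comment> \<open>Preimages of the unit vectors form the columns of a right inverse.\<close>
  then obtain b where b: "\<And>j. b j \<in> carrier_vec n" "\<And>j. A *\<^sub>v b j = unit_vec m j" by metis
  define B where "B = mat n m (\<lambda>(i,j). b j $ i)"
  have B: "B \<in> carrier_mat n m" by (simp add: B_def)
  have AB: "A * B = 1\<^sub>m m"
  proof (rule eq_matI)
    fix i j assume "i < dim_row (1\<^sub>m m :: complex mat)" "j < dim_col (1\<^sub>m m :: complex mat)"
    then have ij: "i < m" "j < m" by auto
    have "col B j = b j" using b(1)[of j] ij by (intro eq_vecI) (auto simp: B_def)
    then have "(A * B) $$ (i,j) = (A *\<^sub>v b j) $ i" using Am B ij by auto
    then show "(A * B) $$ (i,j) = 1\<^sub>m m $$ (i,j)" using b(2) ij by simp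
  qed (use Am B in auto)
  \<comment> \<open>The right inverse is also a left inverse by injectivity: \<open>A\<close> maps
    \<open>?u - v\<close> to zero.\<close>
  have "(B * A) *\<^sub>v v = 1\<^sub>m n *\<^sub>v v" if v: "v \<in> carrier_vec n" for v
  proof -
    let ?u = "B *\<^sub>v (A *\<^sub>v v)"
    have u: "?u \<in> carrier_vec n" using Am B v by auto
    have "A *\<^sub>v ?u = (A * B) *\<^sub>v (A *\<^sub>v v)" using Am B v by (simp add: assoc_mult_mat_vec[of A m n])
    also have "\<dots> = A *\<^sub>v v" using Am v by (simp add: AB)
    finally have "A *\<^sub>v (?u - v) = 0\<^sub>v m"
      using Am u v by (simp add: mult_minus_distrib_mat_vec[of A m n] minus_cancel_vec[of _ m])
    then have "?u - v = 0\<^sub>v n" using schur_kernel[OF R rS A ne] u v by simp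
    then have "(?u - v) $ i = 0" if "i < n" for i using that by simp
    then have "?u = v" using u v B by (intro eq_vecI) auto
    then show ?thesis using Am B v by (simp add: assoc_mult_mat_vec[of B n m])
  qed
  then have BA: "B * A = 1\<^sub>m n" using Am B by (intro mat_eqI_mult_vec[of _ n n]) auto
  have "mat_trace (R g) = mat_trace (S g)" if g: "g \<in> carrier G" for g
  proof -
    have Rg: "R g \<in> carrier_mat n n" and Sg: "S g \<in> carrier_mat m m"
      using rep_carrier g rR rS by auto
    have "R g = (B * A) * R g" using Rg by (simp add: BA)
    also have "\<dots> = B * (S g * A)" using Am B Rg AR[OF g] by (simp add: assoc_mult_mat[of B n m A n "R g" n])
    finally have "mat_trace (R g) = mat_trace ((S g * A) * B)"
      using mat_trace_mult_comm[of B n m "S g * A"] Am B Sg by simp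
    also have "(S g * A) * B = S g" using Am B Sg AB by (simp add: assoc_mult_mat[of "S g" m m A n B m])
    finally show ?thesis .
  qed
  then show ?thesis by (auto simp: rep_character_def)
qed

text \<open>Over the complex numbers \<open>A\<close> has an eigenvalue \<open>c\<close>. Then
  \<open>A - c \<cdot>\<^sub>m 1\<^sub>m n\<close> is an intertwiner with a nonzero kernel, so it
  vanishes.\<close>

lemma schur_scalar:
  assumes R: "irreducible_representation G n R" and A: "intertwiner n R n R A"
  obtains c where "A = c \<cdot>\<^sub>m 1\<^sub>m n"
proof -
  have Am: "A \<in> carrier_mat n n" and AR: "\<And>g. g \<in> carrier G \<Longrightarrow> R g * A = A * R g"
    using A by (auto simp: intertwiner_def)
  have rR: "representation G n R" and n: "n > 0" using R by (simp_all add: irreducible_iff)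
  obtain c where "eigenvalue A c" using spectrum_non_empty[OF Am n] by (auto simp: spectrum_def)
  then obtain v where v: "v \<in> carrier_vec n" "v \<noteq> 0\<^sub>v n" "A *\<^sub>v v = c \<cdot>\<^sub>v v"
    using Am by (auto simp: eigenvalue_def eigenvector_def)
  let ?D = "A - c \<cdot>\<^sub>m 1\<^sub>m n"
  have D: "?D \<in> carrier_mat n n" using Am by auto
  have "R g * ?D = ?D * R g" if g: "g \<in> carrier G" for g
  proof -
    have Rg: "R g \<in> carrier_mat n n" using rep_carrier g rR by auto
    have "R g * (c \<cdot>\<^sub>m 1\<^sub>m n) = c \<cdot>\<^sub>m R g" "(c \<cdot>\<^sub>m 1\<^sub>m n) * R g = c \<cdot>\<^sub>m R g"
      using Rg mult_smult_distrib[OF Rg one_carrier_mat] mult_smult_assoc_mat[OF one_carrier_mat Rg] by auto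
    then show ?thesis using Rg Am AR[OF g]
      by (simp add: mult_minus_distrib_mat[of _ n n] minus_mult_distrib_mat[of _ n n])
  qed
  then have I: "intertwiner n R n R ?D" using D by (simp add: intertwiner_def)
  have "(c \<cdot>\<^sub>m 1\<^sub>m n) *\<^sub>v v = c \<cdot>\<^sub>v v" using v(1) by (intro eq_vecI) auto
  then have "?D *\<^sub>v v = 0\<^sub>v n"
    using Am v by (simp add: minus_mult_distrib_mat_vec[of _ n n])
  then have "?D = 0\<^sub>m n n" using schur_kernel[OF R rR I _ v(1)] v(2) by blast
  then have "?D $$ (i,j) = 0" if "i < n" "j < n" for i j
    using that by simp
  moreover have "?D $$ (i,j) = A $$ (i,j) - (c \<cdot>\<^sub>m 1\<^sub>m n) $$ (i,j)" if "i < n" "j < n" for i j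
    using that Am by simp
  ultimately have "A $$ (i,j) = (c \<cdot>\<^sub>m 1\<^sub>m n) $$ (i,j)" if "i < n" "j < n" for i j
    using that by (metis eq_iff_diff_eq_0)
  then have "A = c \<cdot>\<^sub>m 1\<^sub>m n" using Am by (intro eq_matI) auto
  then show ?thesis by (rule that)
qed

section \<open>Orthogonality of irreducible characters\<close>

lemma sum_translate:
  assumes h: "h \<in> carrier G"
  shows "(\<Sum>g\<in>carrier G. f (h \<otimes> g)) = (\<Sum>g\<in>carrier G. f g)"
proof -
  have "bij_betw (\<lambda>g. h \<otimes> g) (carrier G) (carrier G)"
    using h by (intro bij_betwI[where g = "\<lambda>g. inv h \<otimes> g"]) (auto simp: m_assoc[symmetric])
  then show ?thesis by (rule sum.reindex_bij_betw)
qed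

text \<open>The sum over \<open>g\<close> of \<open>S g * X * R (inv g)\<close> for the matrix unit \<open>X\<close> at position \<open>(i, j)\<close>.\<close>
definition avg :: "nat \<Rightarrow> ('a \<Rightarrow> complex mat) \<Rightarrow> nat \<Rightarrow> ('a \<Rightarrow> complex mat) \<Rightarrow> nat \<Rightarrow> nat \<Rightarrow> complex mat" where
  "avg n R m S i j = mat m n (\<lambda>(k,l). \<Sum>g\<in>carrier G. S g $$ (k,i) * R (inv g) $$ (j,l))"

lemma rep_mult_index:
  assumes R: "representation G n R" and "g \<in> carrier G" "h \<in> carrier G" "i < n" "j < n"
  shows "R (g \<otimes> h) $$ (i,j) = (\<Sum>k<n. R g $$ (i,k) * R h $$ (k,j))"
  using rep_mult[OF R, of g h] rep_carrier[OF R, of g] rep_carrier[OF R, of h] assms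
  by (simp add: scalar_prod_def lessThan_atLeast0)

text \<open>Translating the summation variable by \<open>h\<close> turns a factor \<open>S h\<close>
  on the left into a factor \<open>R h\<close> on the right.\<close>

lemma intertwiner_avg:
  assumes R: "representation G n R" and S: "representation G m S" and i: "i < m" and j: "j < n"
  shows "intertwiner n R m S (avg n R m S i j)"
  unfolding intertwiner_def
proof (intro conjI ballI)
  show "avg n R m S i j \<in> carrier_mat m n" by (simp add: avg_def)
  fix h assume h: "h \<in> carrier G"
  note Rh = rep_carrier[OF R h] and Sh = rep_carrier[OF S h]
  show "S h * avg n R m S i j = avg n R m S i j * R h"
  proof (rule eq_matI)
    fix k l assume "k < dim_row (avg n R m S i j * R h)" "l < dim_col (avg n R m S i j * R h)"
    then have kl: "k < m" "l < n" using Rh by (auto simp: avg_def)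
    have "(S h * avg n R m S i j) $$ (k,l) =
        (\<Sum>p<m. S h $$ (k,p) * (\<Sum>g\<in>carrier G. S g $$ (p,i) * R (inv g) $$ (j,l)))"
      using kl Sh by (simp add: avg_def scalar_prod_def lessThan_atLeast0)
    also have "\<dots> = (\<Sum>g\<in>carrier G. (\<Sum>p<m. S h $$ (k,p) * S g $$ (p,i)) * R (inv g) $$ (j,l))"
      by (simp add: sum_distrib_left sum_distrib_right mult.assoc) (rule sum.swap)
    also have "\<dots> = (\<Sum>g\<in>carrier G. S (h \<otimes> g) $$ (k,i) * R (inv g) $$ (j,l))"
      using h kl i by (intro sum.cong) (auto simp: rep_mult_index[OF S])
    \<comment> \<open>Writing \<open>inv g\<close> as \<open>inv (h \<otimes> g) \<otimes> h\<close>
      makes the summand a function of \<open>h \<otimes> g\<close>, ready for translation.\<close>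
    also have "\<dots> = (\<Sum>g\<in>carrier G. S (h \<otimes> g) $$ (k,i) * R (inv (h \<otimes> g) \<otimes> h) $$ (j,l))"
      using h by (intro sum.cong) (auto simp: inv_mult_group m_assoc)
    also have "\<dots> = (\<Sum>g\<in>carrier G. S g $$ (k,i) * R (inv g \<otimes> h) $$ (j,l))"
      by (rule sum_translate[OF h])
    also have "\<dots> = (\<Sum>g\<in>carrier G. \<Sum>p<n. S g $$ (k,i) * R (inv g) $$ (j,p) * R h $$ (p,l))"
      using h kl j by (intro sum.cong) (auto simp: rep_mult_index[OF R] sum_distrib_left mult.assoc)
    also have "\<dots> = (avg n R m S i j * R h) $$ (k,l)"
      using kl Rh by (subst sum.swap) (simp add: avg_def scalar_prod_def lessThan_atLeast0 sum_distrib_right)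
    finally show "(S h * avg n R m S i j) $$ (k,l) = (avg n R m S i j * R h) $$ (k,l)" .
  qed (use Rh Sh in \<open>auto simp: avg_def\<close>)
qed

text \<open>A product of traces is a double sum over diagonal entries, and each term, summed over
  \<open>g\<close>, is one entry of the average of a matrix unit.\<close>

lemma char_inner_eq_avg:
  assumes R: "representation G n R" and S: "representation G m S"
  shows "(\<Sum>g\<in>carrier G. rep_character G S g * rep_character G R (inv g)) =
    (\<Sum>k<m. \<Sum>l<n. avg n R m S k l $$ (k,l))"
proof -
  have "(\<Sum>g\<in>carrier G. rep_character G S g * rep_character G R (inv g)) =
      (\<Sum>g\<in>carrier G. \<Sum>k<m. \<Sum>l<n. S g $$ (k,k) * R (inv g) $$ (l,l))"
    using carrier_matD(1)[OF rep_carrier[OF R]] carrier_matD(1)[OF rep_carrier[OF S]]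
    by (intro sum.cong) (auto simp: rep_character_def mat_trace_def sum_product)
  also have "\<dots> = (\<Sum>k<m. \<Sum>l<n. \<Sum>g\<in>carrier G. S g $$ (k,k) * R (inv g) $$ (l,l))"
    by (subst sum.swap, intro sum.cong refl, rule sum.swap)
  also have "\<dots> = (\<Sum>k<m. \<Sum>l<n. avg n R m S k l $$ (k,l))"
    by (simp add: avg_def)
  finally show ?thesis .
qed

text \<open>For different characters all averages vanish, since a nonzero one would force equality
  by \<open>schur_iso\<close>. For equal characters they are scalar matrices, and only the
  \<open>n\<close> averages with \<open>i = j\<close> contribute, each
  \<open>card (carrier G) / n\<close>.\<close>

lemma irr_orthogonality:
  assumes "\<chi> \<in> Irr G" and "\<psi> \<in> Irr G"
  shows "(\<Sum>g\<in>carrier G. \<chi> g * \<psi> (inv g)) = (if \<chi> = \<psi> then of_nat (card (carrier G)) else 0)"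
proof (cases "\<chi> = \<psi>")
  case False
  obtain n R where R: "irreducible_representation G n R" and \<psi>: "\<psi> = rep_character G R"
    using assms by (auto simp: Irr_def)
  obtain m S where S: "irreducible_representation G m S" and \<chi>: "\<chi> = rep_character G S"
    using assms by (auto simp: Irr_def)
  have rR: "representation G n R" and rS: "representation G m S"
    using R S by (simp_all add: irreducible_iff)
  have "avg n R m S k l = 0\<^sub>m m n" if "k < m" "l < n" for k l
    using schur_iso[OF R S intertwiner_avg[OF rR rS that]] False \<chi> \<psi> by auto
  then show ?thesis using False unfolding \<chi> \<psi> char_inner_eq_avg[OF rR rS] by simp
next
  case True
  \<comment> \<open>As the characters are equal, one representation serves for both factors.\<close>
  obtain n R where R: "irreducible_representation G n R" and \<psi>: "\<psi> = rep_character G R"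
    using assms by (auto simp: Irr_def)
  have rR: "representation G n R" and n: "n > 0"
    using R by (simp_all add: irreducible_iff)
  have "avg n R n R i j $$ (i,j) = (if i = j then of_nat (card (carrier G)) / of_nat n else 0)"
    if ij: "i < n" "j < n" for i j
  proof -
    obtain c where c: "avg n R n R i j = c \<cdot>\<^sub>m 1\<^sub>m n"
      using schur_scalar[OF R intertwiner_avg[OF rR rR ij]] by blast
    \<comment> \<open>The scalar is read off from the trace, where
      \<open>R (inv g) * R g = 1\<^sub>m n\<close> collapses the sum.\<close>
    have "of_nat n * c = mat_trace (avg n R n R i j)" unfolding c by (simp add: mat_trace_def)
    also have "\<dots> = (\<Sum>k<n. \<Sum>g\<in>carrier G. R (inv g) $$ (j,k) * R g $$ (k,i))"
      by (simp add: mat_trace_def avg_def mult.commute)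
    also have "\<dots> = (\<Sum>g\<in>carrier G. \<Sum>k<n. R (inv g) $$ (j,k) * R g $$ (k,i))"
      by (rule sum.swap)
    also have "\<dots> = of_nat (card (carrier G)) * 1\<^sub>m n $$ (j,i)"
    proof -
      have "(\<Sum>k<n. R (inv g) $$ (j,k) * R g $$ (k,i)) = 1\<^sub>m n $$ (j,i)" if g: "g \<in> carrier G" for g
        using rep_mult_index[OF rR inv_closed[OF g] g ij(2,1)] g by (simp add: rep_one[OF rR])
      then show ?thesis by simp
    qed
    finally show ?thesis using c ij n by (auto simp: field_simps)
  qed
  then show ?thesis using True n unfolding True \<psi> char_inner_eq_avg[OF rR rR] by simp
qed

section \<open>Character values: conjugates, bounds and coefficients\<close>

lemma rep_pow:
  assumes R: "representation G n R" and g: "g \<in> carrier G"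
  shows "R (g [^] k) = R g ^\<^sub>m k"
proof (induction k)
  case 0
  then show ?case using rep_carrier[OF R g] by (simp add: rep_one[OF R])
next
  case (Suc k)
  then show ?case using g by (simp add: rep_mult[OF R])
qed

lemma card_pos: "card (carrier G) > 0"
  using fin by (auto simp: card_gt_0_iff)

text \<open>By Lagrange \<open>R g\<close> has finite order dividing
  \<open>N = card (carrier G)\<close>, and \<open>inv g\<close> is the power \<open>N - 1\<close> of
  \<open>g\<close>; the facts on matrices of finite order then apply.\<close>

lemma
  assumes R: "representation G n R" and g: "g \<in> carrier G"
  shows rep_character_inv: "rep_character G R (inv g) = cnj (rep_character G R g)"
    and rep_character_bound: "cmod (rep_character G R g) \<le> real n"
proof -
  define N where "N = card (carrier G)"
  have N: "N > 0" using card_pos by (simp add: N_def)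
  have gN: "g [^] N = \<one>" using pow_order_eq_1[OF g] by (simp add: N_def Coset.order_def)
  have "g [^] (N - 1) \<otimes> g = \<one>"
    using gN N g by (metis Suc_diff_1 nat_pow_Suc)
  then have inv: "inv g = g [^] (N - 1)" using g inv_equality by simp
  have RN: "R g ^\<^sub>m N = 1\<^sub>m n" using rep_pow[OF R g, of N] gN rep_one[OF R] by simp
  note * = mat_trace_finite_order[OF rep_carrier[OF R g] N RN]
  show "rep_character G R (inv g) = cnj (rep_character G R g)"
    using g *(1) unfolding inv by (simp add: rep_character_def rep_pow[OF R])
  show "cmod (rep_character G R g) \<le> real n"
    using g *(2) by (simp add: rep_character_def)
qed

lemma irr_inv:
  assumes "\<chi> \<in> Irr G" and "g \<in> carrier G"
  shows "\<chi> (inv g) = cnj (\<chi> g)"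
  using assms rep_character_inv by (auto simp: Irr_def irreducible_iff)

lemma irr_one:
  assumes "\<chi> \<in> Irr G"
  shows "\<chi> \<one> = of_real (char_degree G \<chi>)" and "char_degree G \<chi> \<ge> 1"
  using assms rep_character_one[OF is_group] by (auto simp: Irr_def irreducible_iff char_degree_def)

lemma irr_bound:
  assumes "\<chi> \<in> Irr G" and "g \<in> carrier G"
  shows "cmod (\<chi> g) \<le> char_degree G \<chi>"
  using assms rep_character_bound rep_character_one[OF is_group]
  by (auto simp: Irr_def irreducible_iff char_degree_def)

lemma irr_norm:
  assumes "\<chi> \<in> Irr G"
  shows "(\<Sum>g\<in>carrier G. (cmod (\<chi> g))\<^sup>2) = real (card (carrier G))"
proof -
  have "of_real (\<Sum>g\<in>carrier G. (cmod (\<chi> g))\<^sup>2) = (\<Sum>g\<in>carrier G. \<chi> g * \<chi> (inv g))"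
    using irr_inv[OF assms] by (simp add: complex_norm_square del: of_real_power)
  also have "\<dots> = of_real (real (card (carrier G)))" using irr_orthogonality[OF assms assms] by simp
  finally show ?thesis by (simp only: of_real_eq_iff)
qed

text \<open>Pairing with \<psi> extracts its coefficient. A finite subset \<open>F\<close> is
  allowed because the proof that \<open>Irr G\<close> is finite already relies on this
  formula.\<close>

lemma sum_irr_times_irr:
  assumes F: "finite F" "F \<subseteq> Irr G" and \<psi>: "\<psi> \<in> F"
  shows "(\<Sum>g\<in>carrier G. (\<Sum>\<chi>\<in>F. c \<chi> * \<chi> g) * \<psi> (inv g)) = of_nat (card (carrier G)) * c \<psi>"
proof -
  have "(\<Sum>g\<in>carrier G. (\<Sum>\<chi>\<in>F. c \<chi> * \<chi> g) * \<psi> (inv g)) =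
      (\<Sum>\<chi>\<in>F. c \<chi> * (\<Sum>g\<in>carrier G. \<chi> g * \<psi> (inv g)))"
    by (simp add: sum_distrib_left sum_distrib_right mult.assoc) (rule sum.swap)
  also have "\<dots> = (\<Sum>\<chi>\<in>F. if \<chi> = \<psi> then c \<psi> * of_nat (card (carrier G)) else 0)"
    using F \<psi> by (intro sum.cong) (auto simp: irr_orthogonality subset_iff)
  also have "\<dots> = of_nat (card (carrier G)) * c \<psi>" using F \<psi> by simp
  finally show ?thesis .
qed

lemma finite_Irr: "finite (Irr G)"
proof -
  \<comment> \<open>Evaluate at 1 the part \<open>s\<close> of the regular character supported on \<open>F\<close>: \<open>(s 1)\<^sup>2\<close> is at most the
    square sum of \<open>s\<close>, which orthogonality computes.\<close>
  have "card F \<le> card (carrier G)" if F: "F \<subseteq> Irr G" "finite F" for F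
  proof -
    define s where "s g = (\<Sum>\<chi>\<in>F. of_real (char_degree G \<chi>) * \<chi> g)" for g
    define D where "D = (\<Sum>\<chi>\<in>F. (char_degree G \<chi>)\<^sup>2)"
    have s1: "s \<one> = of_real D"
      using F irr_one(1) by (auto simp: s_def D_def power2_eq_square subset_iff intro!: sum.cong)
    have "of_real (\<Sum>g\<in>carrier G. (cmod (s g))\<^sup>2) = (\<Sum>g\<in>carrier G. s g * cnj (s g))"
      by (simp add: complex_norm_square del: of_real_power)
    also have "\<dots> = (\<Sum>g\<in>carrier G. \<Sum>\<psi>\<in>F. of_real (char_degree G \<psi>) * (s g * \<psi> (inv g)))"
    proof (rule sum.cong)
      fix g assume "g \<in> carrier G"
      then have "cnj (s g) = (\<Sum>\<psi>\<in>F. of_real (char_degree G \<psi>) * \<psi> (inv g))"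
        using F irr_inv unfolding s_def cnj_sum by (intro sum.cong) (auto simp: subset_iff)
      then show "s g * cnj (s g) = (\<Sum>\<psi>\<in>F. of_real (char_degree G \<psi>) * (s g * \<psi> (inv g)))"
        by (simp add: sum_distrib_left mult_ac)
    qed simp
    also have "\<dots> = (\<Sum>\<psi>\<in>F. of_real (char_degree G \<psi>) * (\<Sum>g\<in>carrier G. s g * \<psi> (inv g)))"
      by (subst sum.swap) (simp add: sum_distrib_left)
    also have "\<dots> = (\<Sum>\<psi>\<in>F. of_real (char_degree G \<psi>) * (of_nat (card (carrier G)) * of_real (char_degree G \<psi>)))"
      using sum_irr_times_irr[OF F(2,1), of _ "\<lambda>\<chi>. of_real (char_degree G \<chi>)"]
      unfolding s_def by (intro sum.cong refl arg_cong2[where f = "(*)"])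
    also have "\<dots> = of_real (real (card (carrier G)) * D)"
      by (simp add: D_def sum_distrib_left power2_eq_square mult_ac)
    finally have eq: "(\<Sum>g\<in>carrier G. (cmod (s g))\<^sup>2) = real (card (carrier G)) * D"
      by (simp only: of_real_eq_iff)
    have D0: "D \<ge> 0" by (simp add: D_def sum_nonneg)
    have "(cmod (s \<one>))\<^sup>2 \<le> (\<Sum>g\<in>carrier G. (cmod (s g))\<^sup>2)"
      using fin by (intro member_le_sum) auto
    \<comment> \<open>The value of \<open>s\<close> at the identity is \<open>D\<close> itself, so
      one summand of the square sum is already \<open>D * D\<close>; cancelling \<open>D\<close>
      bounds it by the group order.\<close>
    then have "D * D \<le> real (card (carrier G)) * D"
      using eq s1 D0 by (simp add: power2_eq_square)
    then have "D \<le> real (card (carrier G))" using D0 by (cases "D = 0") auto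
    \<comment> \<open>Each degree is at least 1, so \<open>D\<close> counts every member of
      \<open>F\<close> at least once.\<close>
    moreover have "real (card F) \<le> D"
    proof -
      have "(\<Sum>\<chi>\<in>F. 1) \<le> D"
        unfolding D_def using F irr_one(2) by (intro sum_mono) (auto simp: subset_iff)
      then show ?thesis by simp
    qed
    ultimately show ?thesis by simp
  qed
  then show ?thesis using finite_if_finite_subsets_card_bdd by blast
qed

section \<open>Multiplicities\<close>

text \<open>
  With \<open>A, B\<close> a retraction onto \<open>W\<close> and \<open>C, D\<close> one onto \<open>ker B\<close> such that \<open>C D = 1 - A B\<close>, the matrices
  \<open>B (R g) A\<close> and \<open>D (R g) C\<close> represent the restriction to \<open>W\<close> and the quotient by \<open>W\<close>; no
  invariant complement is needed to compare traces.
\<close>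
lemma rep_reduce:
  assumes R: "representation G n R" and W: "vec_subspace n W"
    and inv: "\<And>g w. g \<in> carrier G \<Longrightarrow> w \<in> W \<Longrightarrow> R g *\<^sub>v w \<in> W"
    and W0: "W \<noteq> {0\<^sub>v n}" and W1: "W \<noteq> carrier_vec n"
  obtains r s R1 R2 where "representation G r R1" "representation G s R2" "r < n" "s < n"
    "\<And>g. g \<in> carrier G \<Longrightarrow> rep_character G R g = rep_character G R1 g + rep_character G R2 g"
proof -
  obtain r A B where RW: "retract_onto n r A B W" and ABw: "\<And>w. w \<in> W \<Longrightarrow> A *\<^sub>v (B *\<^sub>v w) = w"
    by (rule vec_subspace_retract[OF W]) (rule that)
  have A: "A \<in> carrier_mat n r" and B: "B \<in> carrier_mat r n" and BA: "B * A = 1\<^sub>m r"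
    and AW: "\<And>v. v \<in> carrier_vec r \<Longrightarrow> A *\<^sub>v v \<in> W"
    using RW by (auto simp: retract_onto_def)
  have Wn: "W \<subseteq> carrier_vec n" using W by (simp add: vec_subspace_def)
  let ?K = "{v \<in> carrier_vec n. B *\<^sub>v v = 0\<^sub>v r}"
  have "vec_subspace n ?K"
    using B by (auto simp: vec_subspace_def mult_add_distrib_mat_vec[of _ r n] mult_mat_vec[of _ r n])
  then obtain s C D0 where RK: "retract_onto n s C D0 ?K" and CDw: "\<And>w. w \<in> ?K \<Longrightarrow> C *\<^sub>v (D0 *\<^sub>v w) = w"
    by (rule vec_subspace_retract) (rule that)
  have C: "C \<in> carrier_mat n s" and D0: "D0 \<in> carrier_mat s n" and D0C: "D0 * C = 1\<^sub>m s"
    and CK: "\<And>v. v \<in> carrier_vec s \<Longrightarrow> C *\<^sub>v v \<in> ?K"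
    using RK by (auto simp: retract_onto_def)
  define P where "P = A * B"
  define E where "E = 1\<^sub>m n - P"
  \<comment> \<open>Composing \<open>D0\<close> with \<open>E\<close> makes it vanish on the range
    of \<open>A\<close> while it remains a left inverse of \<open>C\<close>.\<close>
  define D where "D = D0 * E"
  have P: "P \<in> carrier_mat n n" and E: "E \<in> carrier_mat n n" and D: "D \<in> carrier_mat s n"
    using A B D0 by (auto simp: P_def E_def D_def)
  have PA: "P * A = A" using assoc_mult_mat[OF A B A] BA A by (simp add: P_def)
  have BP: "B * P = B" using assoc_mult_mat[OF B A B] BA B by (simp add: P_def)
  have BC: "B * C = 0\<^sub>m r s"
  proof (rule mat_eqI_mult_vec)
    show "(B * C) *\<^sub>v v = 0\<^sub>m r s *\<^sub>v v" if v: "v \<in> carrier_vec s" for v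
      using CK[OF v] assoc_mult_mat_vec[OF B C v] zero_mult_mat_vec[OF v] by simp
  qed (use B C in auto)
  have PC: "P * C = 0\<^sub>m n s" using assoc_mult_mat[OF A B C] BC A by (simp add: P_def)
  have EC: "E * C = C"
  proof -
    have "E * C = C - 0\<^sub>m n s"
      using minus_mult_distrib_mat[OF one_carrier_mat P C] C PC by (simp add: E_def)
    also have "\<dots> = C" using C by (intro eq_matI) auto
    finally show ?thesis .
  qed
  have EA: "E * A = 0\<^sub>m n r"
    using minus_mult_distrib_mat[OF one_carrier_mat P A] A PA by (simp add: E_def)
  have BE: "B * E = 0\<^sub>m r n"
    using mult_minus_distrib_mat[OF B one_carrier_mat P] B BP by (simp add: E_def)
  have DC: "D * C = 1\<^sub>m s" using assoc_mult_mat[OF D0 E C] EC D0C by (simp add: D_def)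
  have DA: "D * A = 0\<^sub>m s r" using assoc_mult_mat[OF D0 E A] EA D0 by (simp add: D_def)
  \<comment> \<open>\<open>E\<close> maps into the kernel of \<open>B\<close>, on which
    \<open>C * D0\<close> acts as the identity.\<close>
  have CD: "C * D = E"
  proof (rule mat_eqI_mult_vec)
    show "(C * D) *\<^sub>v v = E *\<^sub>v v" if v: "v \<in> carrier_vec n" for v
    proof -
      have Ev: "E *\<^sub>v v \<in> carrier_vec n" using E v by simp
      have "B *\<^sub>v (E *\<^sub>v v) = 0\<^sub>v r"
        using assoc_mult_mat_vec[OF B E v] BE zero_mult_mat_vec[OF v] by simp
      then have "C *\<^sub>v (D0 *\<^sub>v (E *\<^sub>v v)) = E *\<^sub>v v" using Ev by (intro CDw) simp
      then show ?thesis
        using assoc_mult_mat_vec[OF C D v] assoc_mult_mat_vec[OF D0 E v] by (simp add: D_def)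
    qed
  qed (use C D E in auto)
  have sum1: "P + E = 1\<^sub>m n" using P by (intro eq_matI) (auto simp: E_def)
  \<comment> \<open>Invariance of \<open>W\<close> as a matrix identity: \<open>R g * A\<close> maps
    into \<open>W\<close>, where the projection \<open>P\<close> is the identity.\<close>
  have PRA: "P * (R g * A) = R g * A" if g: "g \<in> carrier G" for g
  proof (rule mat_eqI_mult_vec)
    have Rg: "R g \<in> carrier_mat n n" using rep_carrier[OF R g] .
    show "P * (R g * A) \<in> carrier_mat n r" "R g * A \<in> carrier_mat n r" using P Rg A by auto
    fix v :: "complex vec" assume v: "v \<in> carrier_vec r"
    let ?w = "R g *\<^sub>v (A *\<^sub>v v)"
    have w: "(R g * A) *\<^sub>v v = ?w" using assoc_mult_mat_vec[OF Rg A v] .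
    have wn: "?w \<in> carrier_vec n" using Rg A v by simp
    have "(P * (R g * A)) *\<^sub>v v = P *\<^sub>v ?w"
      using assoc_mult_mat_vec[OF P _ v, of "R g * A"] Rg A w by simp
    also have "\<dots> = A *\<^sub>v (B *\<^sub>v ?w)" using assoc_mult_mat_vec[OF A B wn] by (simp add: P_def)
    also have "\<dots> = ?w" using inv[OF g AW[OF v]] by (rule ABw)
    finally show "(P * (R g * A)) *\<^sub>v v = (R g * A) *\<^sub>v v" using w by simp
  qed
  define R1 where "R1 g = B * (R g * A)" for g
  define R2 where "R2 g = D * (R g * C)" for g
  have R1: "representation G r R1"
    unfolding representation_iff
  proof (intro conjI ballI)
    show "R1 g \<in> carrier_mat r r" if "g \<in> carrier G" for g
      using rep_carrier[OF R that] A B by (simp add: R1_def)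
    show "R1 \<one> = 1\<^sub>m r" using A BA by (simp add: R1_def rep_one[OF R])
    fix g h assume g: "g \<in> carrier G" and h: "h \<in> carrier G"
    note Rg = rep_carrier[OF R g] and Rh = rep_carrier[OF R h]
    have RhA: "R h * A \<in> carrier_mat n r" and BRA: "B * (R h * A) \<in> carrier_mat r r" and RgA: "R g * A \<in> carrier_mat n r"
      using Rg Rh A B by auto
    have "R1 g * R1 h = B * ((R g * A) * (B * (R h * A)))"
      using assoc_mult_mat[OF B RgA BRA] by (simp add: R1_def)
    also have "(R g * A) * (B * (R h * A)) = R g * (A * (B * (R h * A)))"
      using assoc_mult_mat[OF Rg A BRA] .
    also have "A * (B * (R h * A)) = R h * A"
      using assoc_mult_mat[OF A B RhA] PRA[OF h] by (simp add: P_def)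
    also have "R g * (R h * A) = (R g * R h) * A" using assoc_mult_mat[OF Rg Rh A] by simp
    finally show "R1 (g \<otimes> h) = R1 g * R1 h" by (simp add: R1_def rep_mult[OF R g h])
  qed
  have R2: "representation G s R2"
    unfolding representation_iff
  proof (intro conjI ballI)
    show "R2 g \<in> carrier_mat s s" if "g \<in> carrier G" for g
      using rep_carrier[OF R that] C D by (simp add: R2_def)
    show "R2 \<one> = 1\<^sub>m s" using C DC by (simp add: R2_def rep_one[OF R])
    fix g h assume g: "g \<in> carrier G" and h: "h \<in> carrier G"
    note Rg = rep_carrier[OF R g] and Rh = rep_carrier[OF R h]
    have RhC: "R h * C \<in> carrier_mat n s" and DRC: "D * (R h * C) \<in> carrier_mat s s"
      and RgC: "R g * C \<in> carrier_mat n s" and DRg: "D * R g \<in> carrier_mat s n"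
      and PRhC: "P * (R h * C) \<in> carrier_mat n s" and BRhC: "B * (R h * C) \<in> carrier_mat r s"
      and RgA: "R g * A \<in> carrier_mat n r"
      using Rg Rh C D P A B by auto
    \<comment> \<open>The vanishing off-diagonal block of \<open>R g\<close>: its restriction to
      \<open>W\<close> stays in the range of \<open>A\<close>, which \<open>D\<close> kills.\<close>
    have DRA: "D * (R g * A) = 0\<^sub>m s r"
    proof -
      have BRgA: "B * (R g * A) \<in> carrier_mat r r" using B RgA by simp
      have "D * (R g * A) = D * (A * (B * (R g * A)))"
        using PRA[OF g] assoc_mult_mat[OF A B RgA] by (simp add: P_def)
      also have "\<dots> = 0\<^sub>m s r" using assoc_mult_mat[OF D A BRgA] DA left_mult_zero_mat[OF BRgA] by simp
      finally show ?thesis .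
    qed
    have DRP: "(D * R g) * P = 0\<^sub>m s n"
    proof -
      have "(D * R g) * P = ((D * R g) * A) * B" using assoc_mult_mat[OF DRg A B] by (simp add: P_def)
      also have "(D * R g) * A = 0\<^sub>m s r" using assoc_mult_mat[OF D Rg A] DRA by simp
      finally show ?thesis using B by simp
    qed
    have "R2 g * R2 h = D * ((R g * C) * (D * (R h * C)))"
      using assoc_mult_mat[OF D RgC DRC] by (simp add: R2_def)
    also have "(R g * C) * (D * (R h * C)) = R g * (C * (D * (R h * C)))"
      using assoc_mult_mat[OF Rg C DRC] .
    also have "C * (D * (R h * C)) = E * (R h * C)"
      using assoc_mult_mat[OF C D RhC] CD by simp
    also have "D * (R g * (E * (R h * C))) = ((D * R g) * E) * (R h * C)"
      using assoc_mult_mat[OF D Rg, of "E * (R h * C)" s] assoc_mult_mat[OF DRg E RhC] E RhC by simp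
    \<comment> \<open>Here \<open>E = 1\<^sub>m n - P\<close>, and the \<open>P\<close> part
      disappears by the vanishing block; this is what makes the quotient action
      multiplicative.\<close>
    also have "(D * R g) * E = D * R g"
    proof -
      have "(D * R g) * E = D * R g - 0\<^sub>m s n"
        using mult_minus_distrib_mat[OF DRg one_carrier_mat P] DRP right_mult_one_mat[OF DRg]
        by (simp add: E_def)
      also have "\<dots> = D * R g" using D Rg by (intro eq_matI) auto
      finally show ?thesis .
    qed
    also have "(D * R g) * (R h * C) = D * ((R g * R h) * C)"
      using assoc_mult_mat[OF D Rg RhC] assoc_mult_mat[OF Rg Rh C] by simp
    finally show "R2 (g \<otimes> h) = R2 g * R2 h" by (simp add: R2_def rep_mult[OF R g h])
  qed
  \<comment> \<open>Cyclicity turns the two blocks into \<open>M * P\<close> and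
    \<open>M * E\<close>, and \<open>P + E\<close> is the identity.\<close>
  have tr: "mat_trace (M) = mat_trace (B * (M * A)) + mat_trace (D * (M * C))"
    if M: "M \<in> carrier_mat n n" for M
  proof -
    have MA: "M * A \<in> carrier_mat n r" and MC: "M * C \<in> carrier_mat n s" using M A C by auto
    have "mat_trace (B * (M * A)) = mat_trace ((M * A) * B)" by (rule mat_trace_mult_comm[OF B MA])
    also have "(M * A) * B = M * P" using assoc_mult_mat[OF M A B] by (simp add: P_def)
    finally have 1: "mat_trace (B * (M * A)) = mat_trace (M * P)" .
    have "mat_trace (D * (M * C)) = mat_trace ((M * C) * D)" by (rule mat_trace_mult_comm[OF D MC])
    also have "(M * C) * D = M * E" using assoc_mult_mat[OF M C D] CD by simp
    finally have 2: "mat_trace (D * (M * C)) = mat_trace (M * E)" .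
    have "M = M * P + M * E" using mult_add_distrib_mat[OF M P E] sum1 M by simp
    then have "mat_trace M = mat_trace (M * P + M * E)" by (rule arg_cong)
    also have "\<dots> = mat_trace (M * P) + mat_trace (M * E)"
      using M P E by (intro mat_trace_add) auto
    finally show ?thesis by (simp add: 1 2)
  qed
  \<comment> \<open>The trace identity at the identity matrix counts dimensions. Both parts are then
    strictly smaller once \<open>r\<close> and \<open>s\<close> are nonzero, which is exactly that
    \<open>W\<close> is neither zero nor the whole space.\<close>
  have "n = r + s"
  proof -
    have "(of_nat n :: complex) = of_nat (r + s)"
      using tr[OF one_carrier_mat] A C BA DC by (simp add: mat_trace_one)
    then show ?thesis by (simp only: of_nat_eq_iff)
  qed
  moreover have "r \<noteq> 0"
  proof
    assume r: "r = 0"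
    have "w = 0\<^sub>v n" if "w \<in> W" for w
    proof (rule vec_eq_zero_if_components)
      show "w \<in> carrier_vec n" using that Wn by auto
      fix i assume "i < n"
      then have "(A *\<^sub>v (B *\<^sub>v w)) $ i = 0" using A B r by (simp add: scalar_prod_def)
      then show "w $ i = 0" by (simp add: ABw[OF that])
    qed
    then have "W = {0\<^sub>v n}" using W by (auto simp: vec_subspace_def)
    with W0 show False by simp
  qed
  moreover have "s \<noteq> 0"
  proof
    assume s: "s = 0"
    have E0: "E = 0\<^sub>m n n"
      using C D s by (intro eq_matI) (auto simp: CD[symmetric] scalar_prod_def)
    have "v \<in> W" if v: "v \<in> carrier_vec n" for v
    proof -
      have "v = (P + E) *\<^sub>v v" using v by (simp add: sum1)
      also have "\<dots> = P *\<^sub>v v" using P by (simp add: E0)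
      also have "\<dots> = A *\<^sub>v (B *\<^sub>v v)" using assoc_mult_mat_vec[OF A B v] by (simp add: P_def)
      finally show ?thesis using AW[of "B *\<^sub>v v"] B v by simp
    qed
    with W1 Wn show False by auto
  qed
  ultimately have "r < n" "s < n" by auto
  moreover have "rep_character G R g = rep_character G R1 g + rep_character G R2 g" if "g \<in> carrier G" for g
    using that tr[OF rep_carrier[OF R that]] by (simp add: rep_character_def R1_def R2_def)
  ultimately show ?thesis using that R1 R2 by simp
qed

text \<open>Strong induction on the dimension: a proper nonzero invariant subspace yields two
  smaller representations whose characters, and hence multiplicities, add up.\<close>

lemma rep_character_decompose:
  "representation G n R \<Longrightarrow> \<exists>m :: ('a \<Rightarrow> complex) \<Rightarrow> nat. \<forall>g\<in>carrier G.
     rep_character G R g = (\<Sum>\<chi>\<in>Irr G. of_nat (m \<chi>) * \<chi> g)"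
proof (induction n arbitrary: R rule: less_induct)
  case (less n)
  note R = less.prems
  \<comment> \<open>Irreducibility demands positive dimension, so the zero representation forms its
    own case, with all multiplicities 0.\<close>
  consider "n = 0" | "irreducible_representation G n R" | "n > 0" "\<not> irreducible_representation G n R" by blast
  then show ?case
  proof cases
    case 1
    then have "\<forall>g\<in>carrier G. rep_character G R g = 0"
      using carrier_matD(1)[OF rep_carrier[OF R]] by (simp add: rep_character_def mat_trace_def)
    then show ?thesis by (intro exI[of _ "\<lambda>_. 0"]) simp
  next
    case 2
    then have "rep_character G R \<in> Irr G" by (auto simp: Irr_def)
    moreover have "(\<Sum>\<chi>\<in>Irr G. of_nat (if \<chi> = rep_character G R then 1 else 0) * \<chi> g) =
        (\<Sum>\<chi>\<in>Irr G. if \<chi> = rep_character G R then \<chi> g else 0)" for g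
      by (intro sum.cong) auto
    ultimately show ?thesis using finite_Irr
      by (intro exI[of _ "\<lambda>\<chi>. if \<chi> = rep_character G R then 1 else 0"]) simp
  next
    case 3
    then obtain W where W: "vec_subspace n W" "\<And>g w. g \<in> carrier G \<Longrightarrow> w \<in> W \<Longrightarrow> R g *\<^sub>v w \<in> W"
      "W \<noteq> {0\<^sub>v n}" "W \<noteq> carrier_vec n"
      using R unfolding irreducible_iff by blast
    obtain r s R1 R2 where *: "representation G r R1" "representation G s R2" "r < n" "s < n"
      "\<And>g. g \<in> carrier G \<Longrightarrow> rep_character G R g = rep_character G R1 g + rep_character G R2 g"
      using rep_reduce[OF R W] by metis
    obtain m1 m2 :: "('a \<Rightarrow> complex) \<Rightarrow> nat" where
      "\<forall>g\<in>carrier G. rep_character G R1 g = (\<Sum>\<chi>\<in>Irr G. of_nat (m1 \<chi>) * \<chi> g)"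
      "\<forall>g\<in>carrier G. rep_character G R2 g = (\<Sum>\<chi>\<in>Irr G. of_nat (m2 \<chi>) * \<chi> g)"
      using less.IH[OF *(3,1)] less.IH[OF *(4,2)] by blast
    then show ?thesis using *(5)
      by (intro exI[of _ "\<lambda>\<chi>. m1 \<chi> + m2 \<chi>"]) (simp add: sum.distrib distrib_right)
  qed
qed

section \<open>Products of characters and their multiplicities\<close>

lemma representation_kron:
  assumes R: "representation G n R" and S: "representation G m S"
  shows "representation G (n * m) (\<lambda>g. kron (R g) (S g))"
proof -
  have "kron (R g) (S g) \<in> carrier_mat (n * m) (n * m)" if "g \<in> carrier G" for g
    using rep_carrier[OF R that] rep_carrier[OF S that] by (auto simp: kron_def)
  then show ?thesis
    using rep_carrier[OF R] rep_carrier[OF S]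
    by (auto simp: representation_iff rep_one[OF R] rep_one[OF S] kron_one rep_mult[OF R] rep_mult[OF S]
        intro!: kron_mult)
qed

text \<open>The definite description in \<open>kronecker_mult\<close> has to be discharged: the
  Kronecker product of representations supplies a candidate, orthogonality shows that it is the only
  one.\<close>

lemma kronecker_mult_decomposition:
  assumes \<phi>: "\<phi> \<in> Irr G" and \<psi>: "\<psi> \<in> Irr G" and g: "g \<in> carrier G"
  shows "\<phi> g * \<psi> g = (\<Sum>\<chi>\<in>Irr G. of_nat (kronecker_mult G \<chi> \<phi> \<psi>) * \<chi> g)"
proof -
  define Q where "Q m \<longleftrightarrow> (\<forall>\<chi>. \<chi> \<notin> Irr G \<longrightarrow> m \<chi> = 0) \<and>
        (\<forall>g\<in>carrier G. \<phi> g * \<psi> g = (\<Sum>\<chi>\<in>Irr G. of_nat (m \<chi>) * \<chi> g))" for m :: "('a \<Rightarrow> complex) \<Rightarrow> nat"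
  obtain n R where R: "representation G n R" and \<phi>R: "\<phi> = rep_character G R"
    using \<phi> by (auto simp: Irr_def irreducible_iff)
  obtain k S where S: "representation G k S" and \<psi>S: "\<psi> = rep_character G S"
    using \<psi> by (auto simp: Irr_def irreducible_iff)
  obtain m where m: "\<forall>g\<in>carrier G. rep_character G (\<lambda>g. kron (R g) (S g)) g = (\<Sum>\<chi>\<in>Irr G. of_nat (m \<chi>) * \<chi> g)"
    using rep_character_decompose[OF representation_kron[OF R S]] by blast
  \<comment> \<open>The decomposition leaves \<open>m\<close> arbitrary outside
    \<open>Irr G\<close>, whereas the description asks for 0 there.\<close>
  have ex: "Q (\<lambda>\<chi>. if \<chi> \<in> Irr G then m \<chi> else 0)"
    unfolding Q_def
  proof (intro conjI ballI allI impI)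
    fix h assume h: "h \<in> carrier G"
    have "\<phi> h * \<psi> h = rep_character G (\<lambda>g. kron (R g) (S g)) h"
      using h mat_trace_kron[OF rep_carrier[OF R h] rep_carrier[OF S h]]
      by (simp add: \<phi>R \<psi>S rep_character_def)
    then show "\<phi> h * \<psi> h = (\<Sum>\<chi>\<in>Irr G. of_nat (if \<chi> \<in> Irr G then m \<chi> else 0) * \<chi> h)"
      using m h by simp
  qed simp
  have uniq: "m1 = m2" if Q1: "Q m1" and Q2: "Q m2" for m1 m2
  proof
    fix \<chi>
    show "m1 \<chi> = m2 \<chi>"
    proof (cases "\<chi> \<in> Irr G")
      case True
      \<comment> \<open>The right-hand side depends on the product character alone, so any two
        solutions agree on \<open>Irr G\<close>.\<close>
      have *: "of_nat (card (carrier G)) * of_nat (m \<chi>) = (\<Sum>g\<in>carrier G. (\<phi> g * \<psi> g) * \<chi> (inv g))"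
        if "Q m" for m
        using that sum_irr_times_irr[OF finite_Irr subset_refl True, of "\<lambda>\<chi>. of_nat (m \<chi>)"] by (simp add: Q_def)
      have "(of_nat (card (carrier G)) * of_nat (m1 \<chi>) :: complex) = of_nat (card (carrier G)) * of_nat (m2 \<chi>)"
        unfolding *[OF Q1] *[OF Q2] ..
      then show ?thesis using card_pos by simp
    qed (use Q1 Q2 in \<open>simp add: Q_def\<close>)
  qed
  have "Q (THE m. Q m)" using theI[of Q, OF ex uniq[OF _ ex]] .
  moreover have "(\<lambda>\<chi>. kronecker_mult G \<chi> \<phi> \<psi>) = (THE m. Q m)"
    unfolding kronecker_mult_def Q_def ..
  ultimately have "Q (\<lambda>\<chi>. kronecker_mult G \<chi> \<phi> \<psi>)" by (rule ssubst[rotated])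
  then show ?thesis using g unfolding Q_def by blast
qed

lemma kronecker_mult_le_degree:
  assumes \<phi>: "\<phi> \<in> Irr G" and \<psi>: "\<psi> \<in> Irr G" and \<rho>: "\<rho> \<in> Irr G"
  shows "real (kronecker_mult G \<rho> \<phi> \<psi>) \<le> char_degree G \<rho>"
proof -
  let ?N = "real (card (carrier G))" and ?d = "char_degree G \<rho>"
  have d: "?d \<ge> 1" using irr_one(2)[OF \<rho>] .
  have "of_nat (card (carrier G)) * of_nat (kronecker_mult G \<rho> \<phi> \<psi>) = (\<Sum>g\<in>carrier G. (\<phi> g * \<psi> g) * \<rho> (inv g))"
    using sum_irr_times_irr[OF finite_Irr subset_refl \<rho>, of "\<lambda>\<chi>. of_nat (kronecker_mult G \<chi> \<phi> \<psi>)"]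
    by (simp add: kronecker_mult_decomposition[OF \<phi> \<psi>])
  then have "?N * real (kronecker_mult G \<rho> \<phi> \<psi>) = cmod (\<Sum>g\<in>carrier G. (\<phi> g * \<psi> g) * \<rho> (inv g))"
    by (metis norm_mult norm_of_nat)
  \<comment> \<open>Pointwise, the inequality of arithmetic and geometric means takes the place of
    Cauchy-Schwarz. Nothing is lost, as both square sums equal the group order.\<close>
  also have "\<dots> \<le> (\<Sum>g\<in>carrier G. ((cmod (\<phi> g))\<^sup>2 + (cmod (\<psi> g))\<^sup>2) / 2 * ?d)"
  proof (rule sum_norm_le)
    fix g assume g: "g \<in> carrier G"
    have "cmod (\<phi> g) * cmod (\<psi> g) \<le> ((cmod (\<phi> g))\<^sup>2 + (cmod (\<psi> g))\<^sup>2) / 2"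
      using sum_squares_bound[of "cmod (\<phi> g)" "cmod (\<psi> g)"] by simp
    moreover have "cmod (\<rho> (inv g)) \<le> ?d" using irr_bound[OF \<rho>] g by simp
    ultimately show "cmod ((\<phi> g * \<psi> g) * \<rho> (inv g)) \<le> ((cmod (\<phi> g))\<^sup>2 + (cmod (\<psi> g))\<^sup>2) / 2 * ?d"
      unfolding norm_mult by (intro mult_mono) auto
  qed
  also have "\<dots> = (?N + ?N) / 2 * ?d"
    by (simp add: irr_norm[OF \<phi>, symmetric] irr_norm[OF \<psi>] sum.distrib sum_distrib_right sum_divide_distrib
        flip: sum_divide_distrib sum_distrib_right)
  finally show ?thesis using card_pos by simp
qed

end

theorem theorem1p2:
  fixes G :: "('a, 'b) monoid_scheme"
    and \<phi> \<psi> :: "'a \<Rightarrow> complex"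
    and a :: real
  assumes "group G" and "finite (carrier G)"
    and "\<phi> \<in> Irr G" and "\<psi> \<in> Irr G"
    and "a \<ge> 1"
    and "char_degree G \<phi> \<ge> largest_degree G / a"
    and "char_degree G \<psi> \<ge> largest_degree G / a"
  shows "\<exists>\<rho>\<in>Irr G.
           char_degree G \<rho> \<ge> largest_degree G / (a * sqrt (real (irr_count G))) \<and>
           real (kronecker_mult G \<rho> \<phi> \<psi>) \<ge> largest_degree G / (a\<^sup>2 * real (irr_count G))"
proof -
  interpret fin_group G using assms by (simp add: fin_group_def fin_group_axioms_def)
  let ?b = "largest_degree G" and ?k = "real (irr_count G)"
  let ?g = "\<lambda>\<rho>. real (kronecker_mult G \<rho> \<phi> \<psi>)" and ?d = "char_degree G"
  have d_le: "?d \<chi> \<le> ?b" if "\<chi> \<in> Irr G" for \<chi>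
    unfolding largest_degree_def using that finite_Irr by (intro Max_ge) auto
  have b: "?b > 0" using irr_one(2)[OF assms(3)] d_le[OF assms(3)] by simp
  have k: "?k > 0" using finite_Irr assms(3) by (auto simp: irr_count_def card_gt_0_iff)
  have a: "a > 0" using assms(5) by simp
  \<comment> \<open>The decomposition evaluated at the identity, where every character takes its
    degree as value.\<close>
  have "of_real (?d \<phi> * ?d \<psi>) = (of_real (\<Sum>\<rho>\<in>Irr G. ?g \<rho> * ?d \<rho>) :: complex)"
    using kronecker_mult_decomposition[OF assms(3,4) one_closed] irr_one(1)[OF assms(3)] irr_one(1)[OF assms(4)]
    by (simp add: irr_one(1))
  then have sum: "?d \<phi> * ?d \<psi> = (\<Sum>\<rho>\<in>Irr G. ?g \<rho> * ?d \<rho>)" by (simp only: of_real_eq_iff)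
  \<comment> \<open>The lower bound for the average of the \<open>?k\<close> products. It is chosen
    to serve twice: it is the square of the required bound on the degree, and \<open>?b\<close>
    times the required bound on the multiplicity.\<close>
  define t where "t = ?b\<^sup>2 / (a\<^sup>2 * ?k)"
  have "\<exists>\<rho>\<in>Irr G. t \<le> ?g \<rho> * ?d \<rho>"
  proof (rule ccontr)
    assume "\<not> (\<exists>\<rho>\<in>Irr G. t \<le> ?g \<rho> * ?d \<rho>)"
    then have "(\<Sum>\<rho>\<in>Irr G. ?g \<rho> * ?d \<rho>) < (\<Sum>\<rho>\<in>Irr G. t)"
      using finite_Irr assms(3) by (intro sum_strict_mono) auto
    also have "\<dots> = (?b / a) * (?b / a)"
      using k a by (simp add: t_def irr_count_def power2_eq_square)
    also have "\<dots> \<le> ?d \<phi> * ?d \<psi>"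
      using assms(6,7) a b irr_one(2)[OF assms(3)] by (intro mult_mono) (simp_all del: divide_le_eq le_divide_eq)
    finally show False using sum by simp
  qed
  then obtain \<rho> where \<rho>: "\<rho> \<in> Irr G" and t: "t \<le> ?g \<rho> * ?d \<rho>" by blast
  have d0: "?d \<rho> \<ge> 1" using irr_one(2)[OF \<rho>] .
  have "t \<le> ?d \<rho> * ?d \<rho>"
    using t mult_right_mono[OF kronecker_mult_le_degree[OF assms(3,4) \<rho>], of "?d \<rho>"] d0 by linarith
  moreover have "t = (?b / (a * sqrt ?k))\<^sup>2" using k by (simp add: t_def power_divide power_mult_distrib)
  ultimately have "(?b / (a * sqrt ?k))\<^sup>2 \<le> (?d \<rho>)\<^sup>2" by (simp only: power2_eq_square)
  then have "?b / (a * sqrt ?k) \<le> ?d \<rho>" by (rule power2_le_imp_le) (use d0 in simp)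
  moreover have "?b / (a\<^sup>2 * ?k) \<le> ?g \<rho>"
  proof -
    have "?g \<rho> * ?d \<rho> \<le> ?g \<rho> * ?b" using d_le[OF \<rho>] by (intro mult_left_mono) auto
    moreover have "t = (?b / (a\<^sup>2 * ?k)) * ?b" by (simp add: t_def power2_eq_square)
    ultimately have "(?b / (a\<^sup>2 * ?k)) * ?b \<le> ?g \<rho> * ?b" using t by linarith
    then show ?thesis using b by (rule mult_right_le_imp_le)
  qed
  ultimately show ?thesis using \<rho> by blast
qed

end
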